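(* Let $k$ be a field, $n\ge1$, and let $Q_n$ be the quiver $1\to2\to\cdots\to n$. The set of words $$W_n=\{J_r\cdot J_{r-1}\cdots J_1 \mid 0\le r\le n,\ J_r\succ J_{r-1}\succ\dots\succ J_1 \text{ non-empty intervals in } \{1,\dots,n\}\}$$ (with the empty word for $r=0$) is an admissible normal form associated with $Q_n$.
   Context: Intervals. An interval $J=\{i,i+1,\dots,j\}$ of positive integers is also identified with the word $i\cdot(i+1)\cdots j$; for intervals $J,I$, $J\succ I$ means $\min J>\min I$ and $\max J>\max I$. Juxtaposition of words is concatenation. Algebra $\mathcal{B}_Q$ for a finite acyclic quiver $Q$ with vertex set $Q_0$: the unital associative $k$-algebra with generators $X_t$ ($t\in Q_0$) and relations $X_s^2=X_s$ for all $s$; $X_sX_tX_s=X_tX_sX_t$ for all $s,t$; $X_tX_sX_t=X_sX_t$ whenever there is no arrow from $t$ to $s$. For a word $w=w_1\cdots w_m$ over $Q_0$, $X_w=X_{w_1}\cdots X_{w_m}$ (and $X_\emptyset=1$). Projection functors. For $t\in Q_0$, $\mathsf{P}_t$ is the endofunctor of the category of finite dimensional $Q$-representations over $k$ sending $V$ to $V/\mathsf{t}_{S_t}(V)$, where $\mathsf{t}_{S_t}(V)$ is the greatest submodule of $V$ isomorphic to a direct sum of copies of the simple representation $S_t$ at $t$; $\mathsf{P}_w=\mathsf{P}_{w_1}\circ\cdots\circ\mathsf{P}_{w_m}$. A set $W$ of words over $Q_0$ is an admissible normal form associated with $Q$ if: (1) $W$ contains the empty word and all one-letter words; (2) $\{X_w\mid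 w\in W\}\subseteq \mathcal{B}_Q$ is closed under right multiplication with each generator $X_t$, $t\in Q_0$; (3) for all $v\ne w$ in $W$ there is a finite dimensional $Q$-representation $V$ over $k$ with $\mathsf{P}_vV\not\cong\mathsf{P}_wV$. *)

theory Defs
  imports "HOL-Algebra.QuotRing" "Jordan_Normal_Form.VS_Connect" "Graph_Theory.Digraph"
begin

text \<open>
  Quivers are the directed multigraphs of \<^typ>\<open>('v, 'a) pre_digraph\<close>; an arrow \<open>a\<close> goes from
  \<open>tail Q a\<close> to \<open>head Q a\<close>. The base field is a type \<open>'k\<close> of class \<^class>\<open>field\<close>, used as a ring
  record via \<^term>\<open>class_ring\<close>.
\<close>

definition finite_acyclic_quiver :: "('v, 'a) pre_digraph \<Rightarrow> bool" where
  "finite_acyclic_quiver Q \<longleftrightarrow> fin_digraph Q \<and> acyclic (arcs_ends Q)"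

definition linear_quiver :: "nat \<Rightarrow> (nat, nat) pre_digraph" where
  "linear_quiver n = \<lparr>verts = {1..n}, arcs = {1..<n}, tail = (\<lambda>i. i), head = Suc\<rparr>"


section \<open>The algebra of a quiver\<close>

text \<open>
  The free unital associative algebra on the vertices: an element is its coefficient function on
  words, and multiplication is convolution for concatenation.
\<close>

definition free_algebra :: "('v, 'a) pre_digraph \<Rightarrow> ('v list \<Rightarrow> 'k::field) ring" where
  "free_algebra Q =
    \<lparr>carrier = {f. finite {w. f w \<noteq> 0} \<and> {w. f w \<noteq> 0} \<subseteq> lists (verts Q)},
     mult = (\<lambda>f g w. \<Sum>(u, v) \<in> {(u, v). u @ v = w}. f u * g v),
     one = (\<lambda>w. if w = [] then 1 else 0),
     zero = (\<lambda>w. 0),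
     add = (\<lambda>f g w. f w + g w)\<rparr>"

definition free_word :: "'v list \<Rightarrow> ('v list \<Rightarrow> 'k::field)" where
  "free_word w = (\<lambda>u. if u = w then 1 else 0)"

definition B_relations :: "('v, 'a) pre_digraph \<Rightarrow> ('v list \<Rightarrow> 'k::field) set" where
  "B_relations Q =
     {free_word [s, s] \<ominus>\<^bsub>free_algebra Q\<^esub> free_word [s] |s. s \<in> verts Q} \<union>
     {free_word [s, t, s] \<ominus>\<^bsub>free_algebra Q\<^esub> free_word [t, s, t] |s t.
        s \<in> verts Q \<and> t \<in> verts Q} \<union>
     {free_word [t, s, t] \<ominus>\<^bsub>free_algebra Q\<^esub> free_word [s, t] |s t.
        s \<in> verts Q \<and> t \<in> verts Q \<and> (t, s) \<notin> arcs_ends Q}"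

definition B_ideal :: "('v, 'a) pre_digraph \<Rightarrow> ('v list \<Rightarrow> 'k::field) set" where
  "B_ideal Q = Idl\<^bsub>free_algebra Q\<^esub> (B_relations Q)"

text \<open>
  The scalars lie in \<^const>\<open>free_algebra\<close> as the multiples of its unit, so a two-sided ring ideal is
  automatically a subspace and the ring quotient is the algebra with the given presentation.
\<close>

definition B_algebra :: "('v, 'a) pre_digraph \<Rightarrow> ('v list \<Rightarrow> 'k::field) set ring" where
  "B_algebra Q = free_algebra Q Quot B_ideal Q"

definition B_gen :: "('v, 'a) pre_digraph \<Rightarrow> 'v \<Rightarrow> ('v list \<Rightarrow> 'k::field) set" where
  "B_gen Q t = B_ideal Q +>\<^bsub>free_algebra Q\<^esub> free_word [t]"

definition B_word :: "('v, 'a) pre_digraph \<Rightarrow> 'v list \<Rightarrow> ('v list \<Rightarrow> 'k::field) set" where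
  "B_word Q w = foldr (\<lambda>t x. B_gen Q t \<otimes>\<^bsub>B_algebra Q\<^esub> x) w \<one>\<^bsub>B_algebra Q\<^esub>"


section \<open>Representations\<close>

record ('v, 'a, 'k, 'e) rep =
  space :: "'v \<Rightarrow> ('k, 'e) module"
  rep_map :: "'a \<Rightarrow> 'e \<Rightarrow> 'e"

definition fin_dim_rep ::
    "('v, 'a) pre_digraph \<Rightarrow> ('v, 'a, 'k::field, 'e) rep \<Rightarrow> bool" where
  "fin_dim_rep Q V \<longleftrightarrow>
     (\<forall>i\<in>verts Q. vectorspace class_ring (space V i) \<and>
                  vectorspace.fin_dim class_ring (space V i)) \<and>
     (\<forall>a\<in>arcs Q. linear_map class_ring (space V (tail Q a)) (space V (head Q a)) (rep_map V a))"

definition rep_isomorphic ::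
    "('v, 'a) pre_digraph \<Rightarrow> ('v, 'a, 'k::field, 'e) rep \<Rightarrow> ('v, 'a, 'k, 'f) rep \<Rightarrow> bool" where
  "rep_isomorphic Q V W \<longleftrightarrow>
     (\<exists>\<phi>. (\<forall>i\<in>verts Q. \<phi> i \<in> LinearCombinations.module_hom class_ring (space V i) (space W i) \<and>
                       bij_betw (\<phi> i) (carrier (space V i)) (carrier (space W i))) \<and>
          (\<forall>a\<in>arcs Q. \<forall>x\<in>carrier (space V (tail Q a)).
             \<phi> (head Q a) (rep_map V a x) = rep_map W a (\<phi> (tail Q a) x)))"

text \<open>
  A submodule is a family of subspaces. Its value outside \<^term>\<open>verts Q\<close> is fixed so that distinct
  families are distinct submodules and pointwise inclusion is the order on submodules.
\<close>

definition subrep ::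
    "('v, 'a) pre_digraph \<Rightarrow> ('v, 'a, 'k::field, 'e) rep \<Rightarrow> ('v \<Rightarrow> 'e set) \<Rightarrow> bool" where
  "subrep Q V U \<longleftrightarrow>
     (\<forall>i\<in>verts Q. VectorSpace.subspace class_ring (U i) (space V i)) \<and>
     (\<forall>i. i \<notin> verts Q \<longrightarrow> U i = {}) \<and>
     (\<forall>a\<in>arcs Q. rep_map V a ` U (tail Q a) \<subseteq> U (head Q a))"

definition rep_of_subrep ::
    "('v, 'a, 'k, 'e) rep \<Rightarrow> ('v \<Rightarrow> 'e set) \<Rightarrow> ('v, 'a, 'k, 'e) rep" where
  "rep_of_subrep V U = V\<lparr>space := (\<lambda>i. (space V i)\<lparr>carrier := U i\<rparr>)\<rparr>"

text \<open>
  The quotient by a submodule is realised on a set of representatives of the cosets, rather than on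
  the cosets themselves, so that its element type is that of the given representation and projection
  functors can be iterated along a word.
\<close>

definition coset_rep :: "('k, 'e) module \<Rightarrow> 'e set \<Rightarrow> 'e \<Rightarrow> 'e" where
  "coset_rep M U x = (SOME y. y \<in> U +>\<^bsub>M\<^esub> x)"

definition quot_space :: "('k, 'e) module \<Rightarrow> 'e set \<Rightarrow> ('k, 'e) module" where
  "quot_space M U = M
    \<lparr>carrier := coset_rep M U ` carrier M,
     zero := coset_rep M U \<zero>\<^bsub>M\<^esub>,
     add := (\<lambda>x y. coset_rep M U (x \<oplus>\<^bsub>M\<^esub> y)),
     smult := (\<lambda>c x. coset_rep M U (c \<odot>\<^bsub>M\<^esub> x))\<rparr>"

definition quot_rep ::
    "('v, 'a) pre_digraph \<Rightarrow> ('v, 'a, 'k, 'e) rep \<Rightarrow> ('v \<Rightarrow> 'e set) \<Rightarrow> ('v, 'a, 'k, 'e) rep" where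
  "quot_rep Q V U =
    \<lparr>space = (\<lambda>i. quot_space (space V i) (U i)),
     rep_map = (\<lambda>a x. coset_rep (space V (head Q a)) (U (head Q a)) (rep_map V a x))\<rparr>"

definition simple_rep :: "'v \<Rightarrow> ('v, 'a, 'k::field, 'k) rep" where
  "simple_rep t =
    \<lparr>space = (\<lambda>i. \<lparr>carrier = (if i = t then UNIV else {0}),
                   mult = (*), one = 1, zero = 0, add = (+), smult = (*)\<rparr>),
     rep_map = (\<lambda>a x. 0)\<rparr>"

text \<open>The direct sum of \<open>m\<close> copies of a representation; \<open>mult\<close> and \<open>one\<close> play no role in a module.\<close>

definition rep_copies :: "nat \<Rightarrow> ('v, 'a, 'k, 'e) rep \<Rightarrow> ('v, 'a, 'k, nat \<Rightarrow> 'e) rep" where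
  "rep_copies m S =
    \<lparr>space = (\<lambda>i. \<lparr>carrier = {..<m} \<rightarrow>\<^sub>E carrier (space S i),
                   mult = undefined, one = undefined,
                   zero = (\<lambda>j\<in>{..<m}. \<zero>\<^bsub>space S i\<^esub>),
                   add = (\<lambda>f g. \<lambda>j\<in>{..<m}. f j \<oplus>\<^bsub>space S i\<^esub> g j),
                   smult = (\<lambda>c f. \<lambda>j\<in>{..<m}. c \<odot>\<^bsub>space S i\<^esub> f j)\<rparr>),
     rep_map = (\<lambda>a f. \<lambda>j\<in>{..<m}. rep_map S a (f j))\<rparr>"


section \<open>Projection functors and admissible normal forms\<close>

text \<open>
  For finite dimensional \<open>V\<close> only finite direct sums of copies of the simple module can embed in
  \<open>V\<close>, so finitely many copies suffice.
\<close>

definition torsion ::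
    "('v, 'a) pre_digraph \<Rightarrow> 'v \<Rightarrow> ('v, 'a, 'k::field, 'e) rep \<Rightarrow> 'v \<Rightarrow> 'e set" where
  "torsion Q t V =
     (GREATEST U. subrep Q V U \<and>
        (\<exists>m. rep_isomorphic Q (rep_of_subrep V U) (rep_copies m (simple_rep t))))"

definition proj_functor ::
    "('v, 'a) pre_digraph \<Rightarrow> 'v \<Rightarrow> ('v, 'a, 'k::field, 'e) rep \<Rightarrow> ('v, 'a, 'k, 'e) rep" where
  "proj_functor Q t V = quot_rep Q V (torsion Q t V)"

definition proj_word ::
    "('v, 'a) pre_digraph \<Rightarrow> 'v list \<Rightarrow> ('v, 'a, 'k::field, 'e) rep \<Rightarrow> ('v, 'a, 'k, 'e) rep" where
  "proj_word Q w = foldr (proj_functor Q) w"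

text \<open>
  The type argument is the base field \<open>'k\<close>. Every finite dimensional vector space over \<open>'k\<close> is isomorphic
  to one whose elements have type \<^typ>\<open>nat \<Rightarrow> 'k\<close>, so the last clause ranges over all finite
  dimensional representations up to isomorphism.
\<close>

definition admissible_normal_form ::
    "'k::field itself \<Rightarrow> ('v, 'a) pre_digraph \<Rightarrow> 'v list set \<Rightarrow> bool" where
  "admissible_normal_form K Q W \<longleftrightarrow>
     finite_acyclic_quiver Q \<and>
     W \<subseteq> lists (verts Q) \<and>
     [] \<in> W \<and> (\<forall>t\<in>verts Q. [t] \<in> W) \<and>
     (\<forall>x \<in> (B_word Q ` W :: ('v list \<Rightarrow> 'k) set set). \<forall>t\<in>verts Q.
        x \<otimes>\<^bsub>B_algebra Q\<^esub> B_gen Q t \<in> B_word Q ` W) \<and>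
     (\<forall>v\<in>W. \<forall>w\<in>W. v \<noteq> w \<longrightarrow>
        (\<exists>V :: ('v, 'a, 'k, nat \<Rightarrow> 'k) rep.
           fin_dim_rep Q V \<and> \<not> rep_isomorphic Q (proj_word Q v V) (proj_word Q w V)))"


section \<open>Words of intervals\<close>

definition intervals :: "nat \<Rightarrow> nat set set" where
  "intervals n = {{i..j} |i j. 1 \<le> i \<and> i \<le> j \<and> j \<le> n}"

definition interval_succ :: "nat set \<Rightarrow> nat set \<Rightarrow> bool"  (infix "\<succ>\<^sub>I" 50) where
  "J \<succ>\<^sub>I I \<longleftrightarrow> Min J > Min I \<and> Max J > Max I"

text \<open>
  The list \<open>Js\<close> is \<open>[J\<^sub>r, \<dots>, J\<^sub>1]\<close>, and \<^term>\<open>sorted_list_of_set J\<close> is the word of the interval \<open>J\<close>.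
\<close>

definition normal_words :: "nat \<Rightarrow> nat list set" where
  "normal_words n =
     {concat (map sorted_list_of_set Js) |Js.
        length Js \<le> n \<and> set Js \<subseteq> intervals n \<and> sorted_wrt (\<succ>\<^sub>I) Js}"

end

theory Submission
  imports Defs
begin

text \<open>
  On \<open>Q\<^sub>n\<close> the relations say that the generators are idempotent, that \<open>X\<^sub>s\<close> and \<open>X\<^sub>t\<close> commute for
  \<open>\<bar>s - t\<bar> > 1\<close>, and that \<open>X\<^sub>s X\<^sub>s\<^sub>+\<^sub>1\<close> absorbs \<open>X\<^sub>s\<close> from the right and \<open>X\<^sub>s\<^sub>+\<^sub>1\<close> from the left. A letter
  \<open>t\<close> multiplied to \<open>J\<^sub>r \<cdots> J\<^sub>1\<close> from the right therefore becomes a new interval if \<open>t < min J\<^sub>1\<close>, is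
  absorbed if \<open>t \<in> J\<^sub>1\<close>, extends \<open>J\<^sub>1\<close> if \<open>t = max J\<^sub>1 + 1\<close> (and then \<open>J\<^sub>1\<close> swallows \<open>J\<^sub>2\<close> if
  \<open>max J\<^sub>2 = t\<close>), and otherwise moves past \<open>J\<^sub>1\<close>.

  For the separation, let \<open>M\<^sub>b\<close> be the representation that is one-dimensional at \<open>1, \<dots>, b\<close> with
  identity maps. Its socle is the simple at \<open>b\<close>, so \<open>P\<^sub>t M\<^sub>b = M\<^sub>b\<close> for \<open>t \<noteq> b\<close> and
  \<open>P\<^sub>b M\<^sub>b = M\<^sub>b\<^sub>-\<^sub>1\<close>. Hence a word acts on the indices \<open>b\<close> by a map of \<open>{0, \<dots>, n}\<close>, and the map of
  a chain of intervals determines the chain: its least moved point reveals \<open>min J\<^sub>1\<close>, the fibre of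
  that point's value reveals \<open>max J\<^sub>1\<close>, and the remaining intervals are read off above \<open>max J\<^sub>1\<close>.
\<close>

section \<open>Chains of intervals\<close>

text \<open>A pair \<open>(a, b)\<close> stands for the interval \<open>{a..b}\<close>; chains list the smallest interval first.\<close>

primrec chain_word :: "(nat \<times> nat) list \<Rightarrow> nat list" where
  "chain_word [] = []"
| "chain_word (J # Js) = chain_word Js @ [fst J..<Suc (snd J)]"

definition interval_chain :: "nat \<Rightarrow> (nat \<times> nat) list \<Rightarrow> bool" where
  "interval_chain n Js \<longleftrightarrow>
     (\<forall>(a, b)\<in>set Js. 1 \<le> a \<and> a \<le> b \<and> b \<le> n) \<and>
     sorted_wrt (\<lambda>(a, b) (c, d). a < c \<and> b < d) Js"

lemma interval_chain_Nil [simp]: "interval_chain n []"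
  by (simp add: interval_chain_def)

lemma interval_chain_Cons:
  "interval_chain n ((a, b) # Js) \<longleftrightarrow>
     1 \<le> a \<and> a \<le> b \<and> b \<le> n \<and> (\<forall>(c, d)\<in>set Js. a < c \<and> b < d) \<and> interval_chain n Js"
  by (auto simp: interval_chain_def)

text \<open>Left endpoints increase strictly inside \<open>{m<..n}\<close>; the bound
  \<open>m\<close> moves up to the first left endpoint in the induction. With \<open>m = 0\<close>
  this supplies the length bound in \<open>normal_words\<close>.\<close>

lemma length_interval_chain:
  assumes "interval_chain n Js" "\<forall>(a, b)\<in>set Js. m < a"
  shows "length Js \<le> n - m"
  using assms
proof (induction Js arbitrary: m)
  case (Cons J Js)
  obtain a b where J: "J = (a, b)" by fastforce
  have "length Js \<le> n - a"
    using Cons by (intro Cons.IH) (auto simp: J interval_chain_Cons)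
  then show ?case
    using Cons.prems by (auto simp: J interval_chain_Cons)
qed simp

lemma chain_word_conv_concat:
  "chain_word Js = concat (map sorted_list_of_set (rev (map (\<lambda>(a, b). {a..b}) Js)))"
proof -
  have "[a..<Suc b] = sorted_list_of_set {a..b}" for a b
    using sorted_list_of_set_range[of a "Suc b"] by (simp add: atLeastLessThanSuc_atLeastAtMost)
  then show ?thesis
    by (induction Js) auto
qed

text \<open>A non-empty interval is recovered from its \<open>Min\<close> and \<open>Max\<close>, so
  lists of sets with the largest first become lists of endpoint pairs with the smallest first, which
  suit structural induction.\<close>

lemma normal_words_eq: "normal_words n = chain_word ` {Js. interval_chain n Js}"
proof (intro equalityI subsetI)
  fix w assume "w \<in> normal_words n"
  then obtain Is where Is: "set Is \<subseteq> intervals n" "sorted_wrt (\<succ>\<^sub>I) Is"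
    and w: "w = concat (map sorted_list_of_set Is)"
    by (auto simp: normal_words_def)
  define Js where "Js = rev (map (\<lambda>J. (Min J, Max J)) Is)"
  have ivl: "\<exists>a b. J = {a..b} \<and> Min J = a \<and> Max J = b \<and> 1 \<le> a \<and> a \<le> b \<and> b \<le> n"
    if J: "J \<in> set Is" for J
  proof -
    obtain a b where ab: "J = {a..b}" "1 \<le> a" "a \<le> b" "b \<le> n"
      using J Is(1) unfolding intervals_def by blast
    then have "Min J = a" "Max J = b"
      by (auto intro!: Min_eqI Max_eqI)
    with ab show ?thesis by blast
  qed
  have "map (\<lambda>J. {Min J..Max J}) Is = Is"
    using ivl by (intro map_idI) fastforce
  then have "chain_word Js = w"
    by (simp add: chain_word_conv_concat w Js_def rev_map comp_def)
  moreover have "interval_chain n Js"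
    unfolding interval_chain_def Js_def
  proof
    show "\<forall>(a, b)\<in>set (rev (map (\<lambda>J. (Min J, Max J)) Is)). 1 \<le> a \<and> a \<le> b \<and> b \<le> n"
      using ivl by fastforce
    show "sorted_wrt (\<lambda>(a, b) (c, d). a < c \<and> b < d) (rev (map (\<lambda>J. (Min J, Max J)) Is))"
      unfolding sorted_wrt_rev sorted_wrt_map case_prod_conv
      by (rule sorted_wrt_mono_rel[OF _ Is(2)]) (simp add: interval_succ_def)
  qed
  ultimately show "w \<in> chain_word ` {Js. interval_chain n Js}" by blast
next
  fix w assume "w \<in> chain_word ` {Js. interval_chain n Js}"
  then obtain Js where Js: "interval_chain n Js" and w: "w = chain_word Js" by blast
  define Is where "Is = rev (map (\<lambda>(a, b). {a..b}) Js)"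
  have "length Is \<le> n"
    using length_interval_chain[OF Js, of 0] Js by (fastforce simp: Is_def interval_chain_def)
  moreover have "set Is \<subseteq> intervals n"
    using Js by (fastforce simp: Is_def interval_chain_def intervals_def)
  moreover have "sorted_wrt (\<succ>\<^sub>I) Is"
    unfolding Is_def sorted_wrt_rev sorted_wrt_map
  proof (rule sorted_wrt_mono_rel)
    show "sorted_wrt (\<lambda>(a, b) (c, d). a < c \<and> b < d) Js"
      using Js by (simp add: interval_chain_def)
    show "(case y of (a, b) \<Rightarrow> {a..b}) \<succ>\<^sub>I (case x of (a, b) \<Rightarrow> {a..b})"
      if "x \<in> set Js" "y \<in> set Js" "(case x of (a, b) \<Rightarrow> \<lambda>(c, d). a < c \<and> b < d) y" for x y
    proof -
      obtain a b c d where xy: "x = (a, b)" "y = (c, d)" by fastforce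
      then have "a \<le> b" "c \<le> d"
        using that(1,2) Js by (auto simp: interval_chain_def)
      then have "Min {a..b} = a" "Max {a..b} = b" "Min {c..d} = c" "Max {c..d} = d"
        by (auto intro!: Min_eqI Max_eqI)
      then show ?thesis
        using that(3) by (simp add: xy interval_succ_def)
    qed
  qed
  ultimately show "w \<in> normal_words n"
    unfolding normal_words_def w chain_word_conv_concat Is_def by blast
qed

lemma set_chain_word:
  assumes "interval_chain n Js"
  shows "set (chain_word Js) \<subseteq> {1..n}"
  using assms
proof (induction Js)
  case (Cons J Js)
  obtain a b where J: "J = (a, b)" by fastforce
  then have "1 \<le> a" "b \<le> n" "set (chain_word Js) \<subseteq> {1..n}"
    using Cons by (simp_all add: interval_chain_Cons)
  then show ?case
    by (simp only: J chain_word.simps set_append set_upt Un_subset_iff) auto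
qed simp


section \<open>Rewriting words by the Catalan relations\<close>

text \<open>These are the defining relations of the Catalan monoid of order-preserving,
  order-decreasing maps. Stating them for a map \<open>F\<close> whose kernel is a congruence on
  words lets rewriting be done by equality of \<open>F\<close>-values.\<close>

locale catalan_presentation =
  fixes F :: "nat list \<Rightarrow> 'a" and n :: nat
  assumes append_cong: "F u = F u' \<Longrightarrow> F v = F v' \<Longrightarrow> F (u @ v) = F (u' @ v')"
    and idem: "s \<in> {1..n} \<Longrightarrow> F [s, s] = F [s]"
    and commute: "s \<in> {1..n} \<Longrightarrow> t \<in> {1..n} \<Longrightarrow> Suc s < t \<Longrightarrow> F [s, t] = F [t, s]"
    and absorb_right: "s \<in> {1..n} \<Longrightarrow> Suc s \<in> {1..n} \<Longrightarrow> F [s, Suc s, s] = F [s, Suc s]"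
    and absorb_left: "s \<in> {1..n} \<Longrightarrow> Suc s \<in> {1..n} \<Longrightarrow> F [Suc s, s, Suc s] = F [s, Suc s]"
begin

lemma append_cong_left: "F u = F u' \<Longrightarrow> F (u @ v) = F (u' @ v)"
  by (rule append_cong) auto

lemma append_cong_right: "F v = F v' \<Longrightarrow> F (u @ v) = F (u @ v')"
  by (rule append_cong) auto

text \<open>The letters of \<open>[a..<b]\<close> are at most \<open>b - 1\<close>, hence at least
  two below \<open>t\<close>, and \<open>t\<close> commutes past them one by one.\<close>

lemma interval_commute:
  assumes "1 \<le> a" "b < t" "t \<le> n"
  shows "F ([a..<b] @ [t]) = F (t # [a..<b])"
  using assms(2)
proof (induction b)
  case (Suc b)
  show ?case
  proof (cases "a \<le> b")
    case True
    have "F ([a..<Suc b] @ [t]) = F ([a..<b] @ [b, t])"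
      using True by simp
    also have "\<dots> = F ([a..<b] @ [t, b])"
      using Suc.prems True assms by (intro append_cong_right commute) auto
    also have "\<dots> = F (([a..<b] @ [t]) @ [b])" by simp
    also have "\<dots> = F ((t # [a..<b]) @ [b])"
      using Suc by (intro append_cong_left) simp
    finally show ?thesis using True by simp
  qed simp
qed simp

text \<open>The letter \<open>t\<close> moves left past everything above \<open>Suc t\<close> and
  then vanishes by \<open>absorb_right\<close>, or by \<open>idem\<close> when the interval ends in
  \<open>t\<close>.\<close>

lemma interval_absorb_right:
  assumes "1 \<le> a" "a \<le> t" "t \<le> b" "b \<le> n"
  shows "F ([a..<Suc b] @ [t]) = F [a..<Suc b]"
  using assms(3,4)
proof (induction b rule: dec_induct)
  case base
  have "F ([a..<t] @ [t, t]) = F ([a..<t] @ [t])"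
    using assms base by (intro append_cong_right idem) auto
  then show ?case using assms by simp
next
  case (step b)
  show ?case
  proof (cases "b = t")
    case True
    have "F ([a..<t] @ [t, Suc t, t]) = F ([a..<t] @ [t, Suc t])"
      using assms step True by (intro append_cong_right absorb_right) auto
    then show ?thesis using assms True by simp
  next
    case False
    have "F ([a..<Suc (Suc b)] @ [t]) = F ([a..<Suc b] @ [Suc b, t])"
      using assms step by simp
    also have "\<dots> = F ([a..<Suc b] @ [t, Suc b])"
      using assms step False by (intro append_cong_right commute[symmetric]) auto
    also have "\<dots> = F (([a..<Suc b] @ [t]) @ [Suc b])" by simp
    also have "\<dots> = F ([a..<Suc b] @ [Suc b])"
      using step by (intro append_cong_left) simp
    finally show ?thesis using assms step by simp
  qed
qed

text \<open>A letter \<open>s\<close> commutes past the letters below \<open>s - 1\<close>, meets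
  \<open>s - 1, s\<close> and vanishes by \<open>absorb_left\<close>. The endpoint \<open>a\<close>
  is excluded because its predecessor is missing from the interval. Whole words \<open>u\<close> are
  treated so that an interval can be swallowed at once.\<close>

lemma interval_absorb_left:
  assumes "1 \<le> a" "b \<le> n" "set u \<subseteq> {a<..b}"
  shows "F (u @ [a..<Suc b]) = F [a..<Suc b]"
  using assms(3)
proof (induction u)
  case (Cons s u)
  then have s: "a < s" "s \<le> b" by auto
  then obtain r where r: "s = Suc r" by (cases s) auto
  have decomp: "[a..<Suc b] = [a..<r] @ [r, s] @ [Suc s..<Suc b]"
  proof -
    have "[a..<Suc b] = [a..<r] @ [r..<Suc b]"
      using s r upt_add_eq_append[of a r "Suc b - r"] by simp
    then show ?thesis
      using s r by (simp add: upt_conv_Cons del: upt_Suc)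
  qed
  have far: "F (s # [a..<r]) = F ([a..<r] @ [s])"
    using interval_commute[of a r s] assms s r by simp
  have "F ((s # u) @ [a..<Suc b]) = F ([s] @ (u @ [a..<Suc b]))" by simp
  also have "\<dots> = F ([s] @ [a..<Suc b])"
    using Cons by (intro append_cong_right) auto
  also have "\<dots> = F ((s # [a..<r]) @ [r, s] @ [Suc s..<Suc b])"
    by (simp add: decomp del: upt_Suc)
  also have "\<dots> = F (([a..<r] @ [s]) @ [r, s] @ [Suc s..<Suc b])"
    by (rule append_cong_left) (rule far)
  also have "\<dots> = F ([a..<r] @ [s, r, s] @ [Suc s..<Suc b])" by simp
  also have "\<dots> = F ([a..<r] @ [r, s] @ [Suc s..<Suc b])"
    using assms s r by (intro append_cong_right append_cong_left) (auto intro!: absorb_left)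
  finally show ?case by (simp add: decomp del: upt_Suc)
qed simp

text \<open>The last conjunct strengthens the induction: when \<open>t\<close> moves past
  \<open>J\<close> into the tail, \<open>J\<close> lies below the old tail and below
  \<open>t\<close>, so it must also lie below the new tail for the result to be a chain.\<close>

lemma chain_word_append_letter:
  assumes "interval_chain n Js" "t \<in> {1..n}"
  shows "\<exists>Ks. interval_chain n Ks \<and> F (chain_word Js @ [t]) = F (chain_word Ks) \<and>
    (\<forall>a b. (\<forall>(c, d)\<in>set Js. a < c \<and> b < d) \<and> a < t \<and> b < t \<longrightarrow> (\<forall>(c, d)\<in>set Ks. a < c \<and> b < d))"
  using assms(1)
proof (induction Js)
  case Nil
  then show ?case
    using assms(2) by (intro exI[of _ "[(t, t)]"]) (auto simp: interval_chain_Cons)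
next
  case (Cons J Js)
  obtain a b where J: "J = (a, b)" by fastforce
  have ab: "1 \<le> a" "a \<le> b" "b \<le> n" "\<forall>(c, d)\<in>set Js. a < c \<and> b < d" "interval_chain n Js"
    using Cons.prems by (auto simp: J interval_chain_Cons)
  have "t < a \<or> a \<le> t \<and> t \<le> b \<or> t = Suc b \<or> Suc b < t"
    by linarith
  \<comment> \<open>Extending \<open>J\<close> to end in \<open>t\<close> breaks the strict order
    exactly if the next interval already ends in \<open>t\<close>, so \<open>t = Suc b\<close> is
    split accordingly.\<close>
  then consider "t < a" | "a \<le> t" "t \<le> b" | "t = Suc b" "\<exists>c Ls. Js = (c, t) # Ls"
    | "t = Suc b" "\<nexists>c Ls. Js = (c, t) # Ls" | "Suc b < t"
    by blast
  then show ?case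
  proof cases
    case 1
    then have "interval_chain n ((t, t) # J # Js)"
      using assms(2) ab Cons.prems by (auto simp: J interval_chain_Cons)
    moreover have "F (chain_word (J # Js) @ [t]) = F (chain_word ((t, t) # J # Js))"
      by simp
    ultimately show ?thesis
      by (intro exI[of _ "(t, t) # J # Js"]) (auto simp del: chain_word.simps)
  next
    case 2
    then have "F (chain_word (J # Js) @ [t]) = F (chain_word (J # Js))"
      using append_cong_right[OF interval_absorb_right, of a t b] ab
      by (simp add: J del: upt_Suc)
    then show ?thesis
      using Cons.prems by blast
  next
    case 3
    then obtain c Ls where Js: "Js = (c, t) # Ls" by blast
    \<comment> \<open>Since \<open>a < c\<close>, the word of \<open>{c..t}\<close> has letters in
      \<open>{a<..t}\<close> only and is absorbed by the extended interval on its right.\<close>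
    have "F (chain_word (J # Js) @ [t]) = F (chain_word Ls @ [c..<Suc t] @ [a..<Suc t])"
      using ab 3 by (simp add: J Js)
    also have "\<dots> = F (chain_word Ls @ [a..<Suc t])"
      using ab assms(2) by (intro append_cong_right interval_absorb_left) (auto simp: Js)
    finally have "F (chain_word (J # Js) @ [t]) = F (chain_word ((a, t) # Ls))" by simp
    moreover have "interval_chain n ((a, t) # Ls)"
      using ab 3 assms(2) by (auto simp: Js interval_chain_Cons)
    ultimately show ?thesis
      by (intro exI[of _ "(a, t) # Ls"]) (auto simp: J Js simp del: chain_word.simps)
  next
    case 4
    \<comment> \<open>The first right endpoint of the tail exceeds \<open>b\<close> and differs from
      \<open>t = Suc b\<close>, so it exceeds \<open>t\<close>; later ones are larger still.\<close>
    have "t < d" if cd: "(c, d) \<in> set Js" for c d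
    proof -
      obtain c' d' Ls where Js: "Js = (c', d') # Ls"
        using cd by (cases Js) auto
      then have "t < d'" using ab 4 by fastforce
      then show ?thesis using cd ab by (auto simp: Js interval_chain_Cons)
    qed
    then have "interval_chain n ((a, t) # Js)"
      using ab 4 assms(2) by (auto simp: interval_chain_Cons)
    moreover have "F (chain_word (J # Js) @ [t]) = F (chain_word ((a, t) # Js))"
      using ab 4 by (simp add: J)
    ultimately show ?thesis
      by (intro exI[of _ "(a, t) # Js"]) (auto simp: J simp del: chain_word.simps)
  next
    case 5
    obtain Ks where Ks: "interval_chain n Ks" "F (chain_word Js @ [t]) = F (chain_word Ks)"
      "\<forall>a b. (\<forall>(c, d)\<in>set Js. a < c \<and> b < d) \<and> a < t \<and> b < t \<longrightarrow>
        (\<forall>(c, d)\<in>set Ks. a < c \<and> b < d)"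
      using Cons.IH[OF ab(5)] by (elim exE conjE)
    have "F (chain_word (J # Js) @ [t]) = F (chain_word Js @ ([a..<Suc b] @ [t]))"
      by (simp add: J)
    also have "\<dots> = F (chain_word Js @ (t # [a..<Suc b]))"
      using ab 5 assms(2) by (intro append_cong_right interval_commute) auto
    also have "\<dots> = F ((chain_word Js @ [t]) @ [a..<Suc b])" by simp
    also have "\<dots> = F (chain_word Ks @ [a..<Suc b])"
      by (rule append_cong_left) (rule Ks(2))
    finally have "F (chain_word (J # Js) @ [t]) = F (chain_word (J # Ks))"
      by (simp add: J)
    moreover have "\<forall>(c, d)\<in>set Ks. a < c \<and> b < d"
      using Ks(3)[rule_format, of a b] ab 5 by simp
    then have "interval_chain n (J # Ks)"
      using ab Ks(1) by (simp add: J interval_chain_Cons)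
    ultimately show ?thesis
      using Ks(3) by (intro exI[of _ "J # Ks"]) (simp add: J del: chain_word.simps)
  qed
qed

end


section \<open>The action of words on indices\<close>

text \<open>The action of the projection functor at \<open>t\<close> on the indices of the
  representations \<open>M\<^sub>b\<close>; index 0 is the zero representation.\<close>

definition shift :: "nat \<Rightarrow> nat \<Rightarrow> nat" where
  "shift t x = (if x = t then t - 1 else x)"

text \<open>\<open>foldr\<close> applies the largest letter first, so an index in
  \<open>{a..b}\<close> descends step by step to \<open>a - 1\<close>. The hypothesis
  \<open>a \<le> Suc b\<close> admits the empty word, which the induction reaches when the last
  letter is peeled off a singleton.\<close>

lemma foldr_shift_interval:
  assumes "1 \<le> a" "a \<le> Suc b"
  shows "foldr shift [a..<Suc b] x = (if a \<le> x \<and> x \<le> b then a - 1 else x)"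
  using assms(2)
proof (induction b arbitrary: x)
  case 0
  then show ?case using assms by (auto simp: shift_def)
next
  case (Suc b)
  show ?case
  proof (cases "a \<le> Suc b")
    case True
    then show ?thesis using Suc.IH assms(1) by (auto simp: shift_def)
  next
    case False
    then show ?thesis using Suc by simp
  qed
qed

text \<open>The smallest interval stands last in the word and acts first. Its value
  \<open>a - 1\<close> lies below every left endpoint of the tail, and such points are fixed by the
  tail.\<close>

lemma foldr_shift_chain_Cons:
  assumes "interval_chain n ((a, b) # Js)"
  shows "foldr shift (chain_word ((a, b) # Js)) x =
    (if a \<le> x \<and> x \<le> b then a - 1 else foldr shift (chain_word Js) x)"
proof -
  have fixed: "foldr shift (chain_word Ks) y = y"
    if "interval_chain n Ks" "\<forall>(d, e)\<in>set Ks. y < d" for Ks and y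
    using that
  proof (induction Ks)
    case (Cons K Ks)
    obtain d e where K: "K = (d, e)" by fastforce
    then show ?case
      using Cons by (auto simp: interval_chain_Cons foldr_shift_interval simp del: upt_Suc)
  qed simp
  have ab: "1 \<le> a" "a \<le> b" "interval_chain n Js" "\<forall>(c, d)\<in>set Js. a < c"
    using assms by (auto simp: interval_chain_Cons)
  have "foldr shift (chain_word Js) (a - 1) = a - 1"
    using ab by (intro fixed) auto
  then show ?thesis
    using ab by (simp add: foldr_shift_interval del: upt_Suc)
qed

text \<open>A point is either fixed or sent to \<open>c - 1\<close> for some left endpoint
  \<open>c\<close>, and \<open>c - 1\<close> is at least \<open>a\<close> because
  \<open>c > a\<close>.\<close>

lemma foldr_shift_chain_ge:
  assumes "interval_chain n Js" "\<forall>(c, d)\<in>set Js. a < c" "a \<le> x"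
  shows "a \<le> foldr shift (chain_word Js) x"
  using assms
proof (induction Js)
  case (Cons J Js)
  obtain c d where J: "J = (c, d)" by fastforce
  show ?case
    using Cons foldr_shift_chain_Cons[of n c d Js x]
    by (auto simp: J interval_chain_Cons simp del: chain_word.simps)
qed simp


text \<open>
  Once \<open>J\<^sub>1\<close> is split off, its map hides the map of the tail below \<open>max J\<^sub>1\<close>; hence the threshold \<open>c\<close>.
\<close>

lemma foldr_shift_chain_inj:
  assumes "interval_chain n Js" "interval_chain n Ks"
    and "\<forall>(a, b)\<in>set Js. c < b" "\<forall>(a, b)\<in>set Ks. c < b"
    and "\<And>x. c < x \<Longrightarrow> foldr shift (chain_word Js) x = foldr shift (chain_word Ks) x"
  shows "Js = Ks"
  using assms
proof (induction Js arbitrary: Ks c)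
  case Nil
  show ?case
  proof (cases Ks)
    case (Cons K Ks')
    obtain a b where K: "K = (a, b)" by fastforce
    have "foldr shift (chain_word Ks) b = a - 1"
      using Nil.prems(2) foldr_shift_chain_Cons[of n a b Ks' b]
      by (simp add: K Cons interval_chain_Cons del: chain_word.simps)
    moreover have "c < b" "1 \<le> a" "a \<le> b"
      using Nil.prems(2,4) by (auto simp: K Cons interval_chain_Cons)
    ultimately show ?thesis
      using Nil.prems(5)[of b] by simp
  qed simp
next
  case (Cons J Js)
  obtain a b where J: "J = (a, b)" by fastforce
  note f = foldr_shift_chain_Cons[OF Cons.prems(1)[unfolded J]]
  have ab: "1 \<le> a" "a \<le> b" "c < b" "\<forall>(c, d)\<in>set Js. a < c \<and> b < d" "interval_chain n Js"
    using Cons.prems(1,3) by (auto simp: J interval_chain_Cons)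
  show ?case
  proof (cases Ks)
    case Nil
    then show ?thesis using f[of b] Cons.prems(5)[of b] ab by (simp add: J del: chain_word.simps(2))
  next
    case Ks: (Cons K Ks')
    obtain a' b' where K: "K = (a', b')" by fastforce
    note f' = foldr_shift_chain_Cons[OF Cons.prems(2)[unfolded K Ks]]
    have ab': "1 \<le> a'" "a' \<le> b'" "c < b'" "\<forall>(c, d)\<in>set Ks'. a' < c \<and> b' < d" "interval_chain n Ks'"
      using Cons.prems(2,4) by (auto simp: K Ks interval_chain_Cons)
    have eq: "(if a \<le> x \<and> x \<le> b then a - 1 else foldr shift (chain_word Js) x) =
        (if a' \<le> x \<and> x \<le> b' then a' - 1 else foldr shift (chain_word Ks') x)" if "c < x" for x
      using f[of x] f'[of x] Cons.prems(5)[OF that] unfolding J K Ks by argo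
    have chains: "interval_chain n ((a, b) # Js)" "interval_chain n ((a', b') # Ks')"
      using Cons.prems(1,2) by (simp_all add: J K Ks)
    \<comment> \<open>The test point \<open>max a (Suc c)\<close> exceeds the threshold and, as
      \<open>c < b\<close>, lies in \<open>{a..b}\<close>. The first chain sends it to
      \<open>a - 1\<close>, whereas a chain with all left endpoints above \<open>a\<close> keeps it
      at or above \<open>a\<close>.\<close>
    have "\<not> a < a'"
    proof
      assume "a < a'"
      moreover have "a \<le> max a (Suc c)" by simp
      ultimately have "a \<le> foldr shift (chain_word ((a', b') # Ks')) (max a (Suc c))"
        using ab' by (intro foldr_shift_chain_ge[OF chains(2)]) auto
      then show False
        using f'[of "max a (Suc c)"] eq[of "max a (Suc c)"] ab
        by (simp add: less_max_iff_disj del: chain_word.simps)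
    qed
    moreover have "\<not> a' < a"
    proof
      assume "a' < a"
      moreover have "a' \<le> max a' (Suc c)" by simp
      ultimately have "a' \<le> foldr shift (chain_word ((a, b) # Js)) (max a' (Suc c))"
        using ab by (intro foldr_shift_chain_ge[OF chains(1)]) auto
      then show False
        using f[of "max a' (Suc c)"] eq[of "max a' (Suc c)"] ab'
        by (simp add: less_max_iff_disj del: chain_word.simps)
    qed
    ultimately have a: "a' = a" by simp
    \<comment> \<open>Neither tail takes a point \<open>x \<ge> a\<close> to \<open>a - 1\<close>;
      so among the points that are above \<open>c\<close> and at least \<open>a\<close>, this value
      marks exactly the first interval and reveals its right endpoint.\<close>
    have ge: "a \<le> foldr shift (chain_word Js) x" if "a \<le> x" for x
      using foldr_shift_chain_ge[of n Js a x] ab that by fastforce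
    have ge': "a \<le> foldr shift (chain_word Ks') x" if "a \<le> x" for x
      using foldr_shift_chain_ge[of n Ks' a x] ab' that a by fastforce
    have b: "b' = b"
    proof (rule ccontr)
      assume "b' \<noteq> b"
      then consider "b < b'" | "b' < b" by linarith
      then show False
      proof cases
        case 1
        then show False using eq[of b'] ge[of b'] ab ab' a by simp
      next
        case 2
        then show False using eq[of b] ge'[of b] ab ab' a by simp
      qed
    qed
    have "Js = Ks'"
    proof (rule Cons.IH)
      show "foldr shift (chain_word Js) x = foldr shift (chain_word Ks') x" if "b < x" for x
        using eq[of x] that ab(3) by (simp add: a b)
    qed (use ab ab' b in auto)
    then show ?thesis by (simp add: J K Ks a b)
  qed
qed


section \<open>Words in the algebra of a quiver\<close>

text \<open>Sums over infinite sets default to 0, so this is what gives the convolution its intended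
  meaning.\<close>

lemma finite_splits: "finite {(u, v). u @ v = (w :: 'a list)}"
proof (rule finite_subset)
  show "{(u, v). u @ v = w} \<subseteq> (\<lambda>i. (take i w, drop i w)) ` {..length w}"
  proof (intro subsetI, elim CollectE case_prodE)
    fix x u v assume "x = (u, v)" "u @ v = w"
    then have "x = (take (length u) w, drop (length u) w)" "length u \<le> length w" by auto
    then show "x \<in> (\<lambda>i. (take i w, drop i w)) ` {..length w}" by blast
  qed
qed simp

text \<open>Both sides sum over the factorisations of \<open>w\<close> into three words; the
  bijection regroups a split of the first factor as a split of the second.\<close>

lemma convolution_assoc:
  fixes f g h :: "'a list \<Rightarrow> 'b :: semiring_0"
  shows "(\<Sum>(u, v)\<in>{(u, v). u @ v = w}. (\<Sum>(p, q)\<in>{(p, q). p @ q = u}. f p * g q) * h v) =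
    (\<Sum>(u, v)\<in>{(u, v). u @ v = w}. f u * (\<Sum>(p, q)\<in>{(p, q). p @ q = v}. g p * h q))"
    (is "?L = ?R")
proof -
  have "?L = (\<Sum>x\<in>{(u, v). u @ v = w}. \<Sum>y\<in>{(p, q). p @ q = fst x}.
      f (fst y) * g (snd y) * h (snd x))"
    by (simp add: case_prod_unfold sum_distrib_right)
  also have "\<dots> = (\<Sum>(x, y)\<in>(SIGMA x:{(u, v). u @ v = w}. {(p, q). p @ q = fst x}).
      f (fst y) * g (snd y) * h (snd x))"
    by (rule sum.Sigma) (auto simp: finite_splits)
  also have "\<dots> = (\<Sum>(x, y)\<in>(SIGMA x:{(u, v). u @ v = w}. {(p, q). p @ q = snd x}).
      f (fst x) * (g (fst y) * h (snd y)))"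
    by (rule sum.reindex_bij_witness[where
          i = "\<lambda>(x, y). ((fst x @ fst y, snd y), (fst x, fst y))" and
          j = "\<lambda>(x, y). ((fst y, snd y @ snd x), (snd y, snd x))"])
      (auto simp: mult.assoc)
  also have "\<dots> = (\<Sum>x\<in>{(u, v). u @ v = w}. \<Sum>y\<in>{(p, q). p @ q = snd x}.
      f (fst x) * (g (fst y) * h (snd y)))"
    by (rule sum.Sigma[symmetric]) (auto simp: finite_splits)
  also have "\<dots> = ?R"
    by (simp add: case_prod_unfold sum_distrib_left)
  finally show ?thesis .
qed

lemma convolution_free_word:
  "(\<Sum>(p, q)\<in>{(p, q). p @ q = w}. free_word u p * free_word v q) =
    (free_word (u @ v) w :: 'k :: field)"
proof -
  have "(\<Sum>(p, q)\<in>{(p, q). p @ q = w}. free_word u p * free_word v q) =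
      (\<Sum>x\<in>{(p, q). p @ q = w}. if x = (u, v) then 1 else (0 :: 'k))"
    by (rule sum.cong) (auto simp: free_word_def split: if_splits)
  also have "\<dots> = free_word (u @ v) w"
    using finite_splits[of w] by (auto simp: free_word_def)
  finally show ?thesis .
qed

lemma convolution_one_left:
  "(\<Sum>(p, q)\<in>{(p, q). p @ q = w}. (if p = [] then 1 else 0) * f q) = (f w :: 'k :: field)"
proof -
  have "(\<Sum>(p, q)\<in>{(p, q). p @ q = w}. (if p = [] then 1 else 0) * f q) =
      (\<Sum>x\<in>{(p, q). p @ q = w}. if x = ([], w) then f w else 0)"
    by (rule sum.cong) (auto split: if_splits)
  then show ?thesis using finite_splits[of w] by simp
qed

lemma convolution_one_right:
  "(\<Sum>(p, q)\<in>{(p, q). p @ q = w}. f p * (if q = [] then 1 else 0)) = (f w :: 'k :: field)"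
proof -
  have "(\<Sum>(p, q)\<in>{(p, q). p @ q = w}. f p * (if q = [] then 1 else 0)) =
      (\<Sum>x\<in>{(p, q). p @ q = w}. if x = (w, []) then f w else 0)"
    by (rule sum.cong) (auto split: if_splits)
  then show ?thesis using finite_splits[of w] by simp
qed

text \<open>A word in the support of a product is a concatenation of words from the two supports, so
  finiteness and the alphabet are inherited.\<close>

lemma free_algebra_mult_closed:
  fixes f g :: "'v list \<Rightarrow> 'k :: field"
  assumes "f \<in> carrier (free_algebra Q)" "g \<in> carrier (free_algebra Q)"
  shows "f \<otimes>\<^bsub>free_algebra Q\<^esub> g \<in> carrier (free_algebra Q)"
proof -
  let ?h = "\<lambda>w. \<Sum>(u, v)\<in>{(u, v). u @ v = w}. f u * g v"
  have supp: "{w. ?h w \<noteq> 0} \<subseteq> (\<lambda>(u, v). u @ v) ` ({w. f w \<noteq> 0} \<times> {w. g w \<noteq> 0})"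
  proof
    fix w assume "w \<in> {w. ?h w \<noteq> 0}"
    then obtain x where "x \<in> {(u, v). u @ v = w}" "(case x of (u, v) \<Rightarrow> f u * g v) \<noteq> 0"
      by (auto elim: sum.not_neutral_contains_not_neutral)
    then show "w \<in> (\<lambda>(u, v). u @ v) ` ({w. f w \<noteq> 0} \<times> {w. g w \<noteq> 0})"
      by (auto simp: image_iff split: prod.splits)
  qed
  have "finite {w. ?h w \<noteq> 0}"
    using assms by (intro finite_subset[OF supp]) (auto simp: free_algebra_def)
  moreover have "{w. ?h w \<noteq> 0} \<subseteq> lists (verts Q)"
    using assms by (intro order_trans[OF supp]) (fastforce simp: free_algebra_def)
  ultimately show ?thesis by (simp add: free_algebra_def)
qed

lemma ring_free_algebra: "ring (free_algebra Q :: ('v list \<Rightarrow> 'k :: field) ring)"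
    (is "ring ?A")
proof (rule ringI)
  show "abelian_group ?A"
  proof (rule abelian_groupI)
    fix f g :: "'v list \<Rightarrow> 'k" assume "f \<in> carrier ?A" "g \<in> carrier ?A"
    then have "finite ({w. f w \<noteq> 0} \<union> {w. g w \<noteq> 0})"
      "{w. f w \<noteq> 0} \<union> {w. g w \<noteq> 0} \<subseteq> lists (verts Q)"
      by (auto simp: free_algebra_def)
    moreover have "{w. f w + g w \<noteq> 0} \<subseteq> {w. f w \<noteq> 0} \<union> {w. g w \<noteq> 0}" by auto
    ultimately have "finite {w. f w + g w \<noteq> 0}" "{w. f w + g w \<noteq> 0} \<subseteq> lists (verts Q)"
      by (blast intro: finite_subset)+
    then show "f \<oplus>\<^bsub>?A\<^esub> g \<in> carrier ?A" by (simp add: free_algebra_def)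
  next
    fix f :: "'v list \<Rightarrow> 'k" assume "f \<in> carrier ?A"
    then show "\<exists>g\<in>carrier ?A. g \<oplus>\<^bsub>?A\<^esub> f = \<zero>\<^bsub>?A\<^esub>"
      by (intro bexI[of _ "\<lambda>w. - f w"]) (auto simp: free_algebra_def)
  qed (auto simp: free_algebra_def algebra_simps)
  show "Group.monoid ?A"
  proof (rule monoidI)
    fix f g :: "'v list \<Rightarrow> 'k" assume "f \<in> carrier ?A" "g \<in> carrier ?A"
    then show "f \<otimes>\<^bsub>?A\<^esub> g \<in> carrier ?A" by (rule free_algebra_mult_closed)
  qed (auto simp: free_algebra_def convolution_assoc convolution_one_left convolution_one_right)
qed (simp_all add: free_algebra_def case_prod_unfold distrib_left distrib_right sum.distrib)

lemma free_word_closed: "w \<in> lists (verts Q) \<Longrightarrow> free_word w \<in> carrier (free_algebra Q)"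
  by (auto simp: free_algebra_def free_word_def)

lemma free_word_mult: "free_word u \<otimes>\<^bsub>free_algebra Q\<^esub> free_word v = free_word (u @ v)"
  by (simp add: free_algebra_def convolution_free_word)

section \<open>The relation ideal and cosets of words\<close>

lemma B_relations_closed:
  "B_relations Q \<subseteq> carrier (free_algebra Q :: ('v list \<Rightarrow> 'k :: field) ring)"
proof -
  interpret ring "free_algebra Q :: ('v list \<Rightarrow> 'k) ring" by (rule ring_free_algebra)
  show ?thesis
    unfolding B_relations_def by (auto intro!: free_word_closed)
qed

lemma ideal_B_ideal: "ideal (B_ideal Q) (free_algebra Q :: ('v list \<Rightarrow> 'k :: field) ring)"
  unfolding B_ideal_def by (intro ring.genideal_ideal ring_free_algebra B_relations_closed)

text \<open>Collapses the iterated product of generators to one coset, so that equality of words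
  becomes membership of a difference in the ideal.\<close>

lemma B_word_eq_coset:
  fixes Q :: "('v, 'a) pre_digraph"
  assumes "w \<in> lists (verts Q)"
  shows "B_word Q w =
    B_ideal Q +>\<^bsub>free_algebra Q\<^esub> (free_word w :: 'v list \<Rightarrow> 'k :: field)"
  using assms
proof (induction w)
  case Nil
  have "(free_word [] :: 'v list \<Rightarrow> 'k) = \<one>\<^bsub>free_algebra Q\<^esub>"
    by (auto simp: free_word_def free_algebra_def)
  then show ?case
    by (simp add: B_word_def B_algebra_def FactRing_def)
next
  case (Cons t w)
  interpret ideal "B_ideal Q" "free_algebra Q :: ('v list \<Rightarrow> 'k) ring" by (rule ideal_B_ideal)
  have "(B_word Q (t # w) :: ('v list \<Rightarrow> 'k) set) = B_gen Q t \<otimes>\<^bsub>B_algebra Q\<^esub> B_word Q w"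
    by (simp add: B_word_def)
  then show ?case
    using Cons rcoset_mult_add[of "free_word [t]" "free_word w"]
    by (simp add: B_gen_def B_algebra_def FactRing_def free_word_closed free_word_mult)
qed

lemma B_word_append:
  fixes Q :: "('v, 'a) pre_digraph"
  assumes "u \<in> lists (verts Q)" "v \<in> lists (verts Q)"
  shows "(B_word Q (u @ v) :: ('v list \<Rightarrow> 'k :: field) set) =
    B_word Q u \<otimes>\<^bsub>B_algebra Q\<^esub> B_word Q v"
proof -
  interpret ideal "B_ideal Q" "free_algebra Q :: ('v list \<Rightarrow> 'k) ring" by (rule ideal_B_ideal)
  show ?thesis
    using assms rcoset_mult_add[of "free_word u" "free_word v"]
    by (simp add: B_word_eq_coset B_algebra_def FactRing_def free_word_closed free_word_mult)
qed

lemma B_gen_eq_word: "t \<in> verts Q \<Longrightarrow> B_gen Q t = B_word Q [t]"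
  by (simp add: B_word_eq_coset B_gen_def)

text \<open>Cosets agree when their representatives differ by an element of the ideal, and the
  relations generate it. All three defining relations enter the algebra through this rule.\<close>

lemma B_word_eqI:
  fixes Q :: "('v, 'a) pre_digraph"
  assumes "free_word u \<ominus>\<^bsub>free_algebra Q\<^esub> free_word v \<in> (B_relations Q :: ('v list \<Rightarrow> 'k :: field) set)"
    and "u \<in> lists (verts Q)" "v \<in> lists (verts Q)"
  shows "(B_word Q u :: ('v list \<Rightarrow> 'k) set) = B_word Q v"
proof -
  interpret A: ring "free_algebra Q :: ('v list \<Rightarrow> 'k) ring" by (rule ring_free_algebra)
  have "free_word u \<ominus>\<^bsub>free_algebra Q\<^esub> free_word v \<in> (B_ideal Q :: ('v list \<Rightarrow> 'k) set)"
    using assms(1) A.genideal_self[OF B_relations_closed] by (auto simp: B_ideal_def)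
  then show ?thesis
    using A.quotient_eq_iff_same_a_r_cos[OF ideal_B_ideal free_word_closed free_word_closed, OF assms(2,3)] assms(2,3)
    by (simp add: B_word_eq_coset)
qed

lemma B_word_idem:
  assumes "s \<in> verts Q"
  shows "(B_word Q [s, s] :: ('v list \<Rightarrow> 'k :: field) set) = B_word Q [s]"
  using assms by (intro B_word_eqI) (auto simp: B_relations_def)

lemma B_word_braid:
  assumes "s \<in> verts Q" "t \<in> verts Q"
  shows "(B_word Q [s, t, s] :: ('v list \<Rightarrow> 'k :: field) set) = B_word Q [t, s, t]"
  using assms by (intro B_word_eqI) (auto simp: B_relations_def)

lemma B_word_no_arrow:
  assumes "s \<in> verts Q" "t \<in> verts Q" "(t, s) \<notin> arcs_ends Q"
  shows "(B_word Q [t, s, t] :: ('v list \<Rightarrow> 'k :: field) set) = B_word Q [s, t]"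
  using assms by (intro B_word_eqI) (auto simp: B_relations_def)


section \<open>Thin representations\<close>

lemma vectorspaceI:
  fixes M :: "('k, 'e) module"
  assumes "field K"
    and "\<And>x y. x \<in> carrier M \<Longrightarrow> y \<in> carrier M \<Longrightarrow> x \<oplus>\<^bsub>M\<^esub> y \<in> carrier M"
    and "\<zero>\<^bsub>M\<^esub> \<in> carrier M"
    and "\<And>x y z. x \<in> carrier M \<Longrightarrow> y \<in> carrier M \<Longrightarrow> z \<in> carrier M \<Longrightarrow>
      (x \<oplus>\<^bsub>M\<^esub> y) \<oplus>\<^bsub>M\<^esub> z = x \<oplus>\<^bsub>M\<^esub> (y \<oplus>\<^bsub>M\<^esub> z)"
    and "\<And>x y. x \<in> carrier M \<Longrightarrow> y \<in> carrier M \<Longrightarrow> x \<oplus>\<^bsub>M\<^esub> y = y \<oplus>\<^bsub>M\<^esub> x"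
    and "\<And>x. x \<in> carrier M \<Longrightarrow> \<zero>\<^bsub>M\<^esub> \<oplus>\<^bsub>M\<^esub> x = x"
    and "\<And>x. x \<in> carrier M \<Longrightarrow> \<exists>y\<in>carrier M. y \<oplus>\<^bsub>M\<^esub> x = \<zero>\<^bsub>M\<^esub>"
    and "\<And>c x. c \<in> carrier K \<Longrightarrow> x \<in> carrier M \<Longrightarrow> c \<odot>\<^bsub>M\<^esub> x \<in> carrier M"
    and "\<And>c d x. c \<in> carrier K \<Longrightarrow> d \<in> carrier K \<Longrightarrow> x \<in> carrier M \<Longrightarrow>
      (c \<oplus>\<^bsub>K\<^esub> d) \<odot>\<^bsub>M\<^esub> x = c \<odot>\<^bsub>M\<^esub> x \<oplus>\<^bsub>M\<^esub> d \<odot>\<^bsub>M\<^esub> x"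
    and "\<And>c x y. c \<in> carrier K \<Longrightarrow> x \<in> carrier M \<Longrightarrow> y \<in> carrier M \<Longrightarrow>
      c \<odot>\<^bsub>M\<^esub> (x \<oplus>\<^bsub>M\<^esub> y) = c \<odot>\<^bsub>M\<^esub> x \<oplus>\<^bsub>M\<^esub> c \<odot>\<^bsub>M\<^esub> y"
    and "\<And>c d x. c \<in> carrier K \<Longrightarrow> d \<in> carrier K \<Longrightarrow> x \<in> carrier M \<Longrightarrow>
      (c \<otimes>\<^bsub>K\<^esub> d) \<odot>\<^bsub>M\<^esub> x = c \<odot>\<^bsub>M\<^esub> (d \<odot>\<^bsub>M\<^esub> x)"
    and "\<And>x. x \<in> carrier M \<Longrightarrow> \<one>\<^bsub>K\<^esub> \<odot>\<^bsub>M\<^esub> x = x"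
  shows "vectorspace K M"
  using assms
  by (intro vectorspace.intro moduleI abelian_groupI) (simp_all add: fieldE(1))

lemma trivial_vectorspace:
  fixes M :: "('k, 'e) module"
  assumes "field K" "carrier M = {\<zero>\<^bsub>M\<^esub>}" "\<zero>\<^bsub>M\<^esub> \<oplus>\<^bsub>M\<^esub> \<zero>\<^bsub>M\<^esub> = \<zero>\<^bsub>M\<^esub>"
    and "\<And>c. c \<in> carrier K \<Longrightarrow> c \<odot>\<^bsub>M\<^esub> \<zero>\<^bsub>M\<^esub> = \<zero>\<^bsub>M\<^esub>"
  shows "vectorspace K M"
proof -
  interpret field K by fact
  show ?thesis using assms by (intro vectorspaceI) simp_all
qed

text \<open>Agreement is asked on the carrier only, because the operations of a quotient are wrapped
  in \<open>coset_rep\<close>, which is controlled only there.\<close>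

lemma vectorspace_cong:
  fixes M N :: "('k, 'e) module"
  assumes "vectorspace K M" "carrier N = carrier M" "\<zero>\<^bsub>N\<^esub> = \<zero>\<^bsub>M\<^esub>"
    and "\<And>x y. x \<in> carrier M \<Longrightarrow> y \<in> carrier M \<Longrightarrow> x \<oplus>\<^bsub>N\<^esub> y = x \<oplus>\<^bsub>M\<^esub> y"
    and "\<And>c x. c \<in> carrier K \<Longrightarrow> x \<in> carrier M \<Longrightarrow> c \<odot>\<^bsub>N\<^esub> x = c \<odot>\<^bsub>M\<^esub> x"
  shows "vectorspace K N"
proof -
  interpret M: vectorspace K M by fact
  show ?thesis
  proof (rule vectorspaceI)
    show "field K" by unfold_locales
    show "\<exists>y\<in>carrier N. y \<oplus>\<^bsub>N\<^esub> x = \<zero>\<^bsub>N\<^esub>" if "x \<in> carrier N" for x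
      using that assms(2-4) by (intro bexI[of _ "\<ominus>\<^bsub>M\<^esub> x"]) (simp_all add: M.M.l_neg)
  qed (use assms(2-5) in \<open>simp_all add: M.M.a_ac M.smult_l_distr M.smult_r_distr M.smult_assoc1\<close>)
qed

text \<open>Cosets of zero are singletons, so the choice is forced and the quotient by zero has the
  very same elements.\<close>

lemma coset_rep_zero:
  fixes M :: "('k, 'e) module"
  assumes "abelian_group M" "x \<in> carrier M"
  shows "coset_rep M {\<zero>\<^bsub>M\<^esub>} x = x"
proof -
  interpret abelian_group M by fact
  have "{\<zero>\<^bsub>M\<^esub>} +>\<^bsub>M\<^esub> x = {x}"
    using assms(2) by (simp add: a_r_coset_def')
  then show ?thesis by (simp add: coset_rep_def)
qed

lemma coset_rep_carrier:
  fixes M :: "('k, 'e) module"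
  assumes "abelian_group M" "x \<in> carrier M"
  shows "coset_rep M (carrier M) x = (SOME y. y \<in> carrier M)"
proof -
  interpret abelian_group M by fact
  have "carrier M +>\<^bsub>M\<^esub> x = carrier M"
    using assms(2) by (intro a_coset_join2) (auto intro: add.subgroup_self)
  then show ?thesis by (simp add: coset_rep_def)
qed

lemma quot_space_zero:
  fixes M :: "('k, 'e) module"
  assumes "vectorspace K M"
  defines "N \<equiv> quot_space M {\<zero>\<^bsub>M\<^esub>}"
  shows "carrier N = carrier M" "\<zero>\<^bsub>N\<^esub> = \<zero>\<^bsub>M\<^esub>"
    and "\<And>x y. x \<in> carrier M \<Longrightarrow> y \<in> carrier M \<Longrightarrow> x \<oplus>\<^bsub>N\<^esub> y = x \<oplus>\<^bsub>M\<^esub> y"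
    and "\<And>c x. c \<in> carrier K \<Longrightarrow> x \<in> carrier M \<Longrightarrow> c \<odot>\<^bsub>N\<^esub> x = c \<odot>\<^bsub>M\<^esub> x"
    and "vectorspace K N"
proof -
  interpret vectorspace K M by fact
  have rep: "coset_rep M {\<zero>\<^bsub>M\<^esub>} x = x" if "x \<in> carrier M" for x
    using that by (intro coset_rep_zero) unfold_locales
  show *: "carrier N = carrier M" "\<zero>\<^bsub>N\<^esub> = \<zero>\<^bsub>M\<^esub>"
    "\<And>x y. x \<in> carrier M \<Longrightarrow> y \<in> carrier M \<Longrightarrow> x \<oplus>\<^bsub>N\<^esub> y = x \<oplus>\<^bsub>M\<^esub> y"
    "\<And>c x. c \<in> carrier K \<Longrightarrow> x \<in> carrier M \<Longrightarrow> c \<odot>\<^bsub>N\<^esub> x = c \<odot>\<^bsub>M\<^esub> x"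
    by (simp_all add: N_def quot_space_def rep)
  show "vectorspace K N"
    using * by (intro vectorspace_cong[OF assms(1)])
qed

text \<open>There is one coset, hence one element. It is chosen inside the carrier of
  \<open>M\<close>, so maps defined on \<open>M\<close> can still be applied to it.\<close>

lemma quot_space_carrier:
  fixes M :: "('k, 'e) module"
  assumes "vectorspace K M"
  defines "N \<equiv> quot_space M (carrier M)"
  shows "carrier N = {\<zero>\<^bsub>N\<^esub>}" "vectorspace K N" "carrier N \<subseteq> carrier M"
proof -
  interpret vectorspace K M by fact
  \<comment> \<open>The chosen representative may differ from the zero of \<open>M\<close>; the
    quotient declares it to be its own zero.\<close>
  define r where "r = (SOME y. y \<in> carrier M)"
  have r: "r \<in> carrier M"
    unfolding r_def by (rule someI[of _ "\<zero>\<^bsub>M\<^esub>"]) simp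
  have rep: "coset_rep M (carrier M) x = r" if "x \<in> carrier M" for x
    unfolding r_def using that by (intro coset_rep_carrier) unfold_locales
  have "coset_rep M (carrier M) ` carrier M = {r}"
    using r rep by auto
  then show *: "carrier N = {\<zero>\<^bsub>N\<^esub>}"
    by (simp add: N_def quot_space_def rep)
  show "carrier N \<subseteq> carrier M"
    using r rep by (auto simp: N_def quot_space_def)
  show "vectorspace K N"
    using r * by (intro trivial_vectorspace) (simp_all add: field_axioms N_def quot_space_def rep)
qed

lemma linear_map_into_trivial:
  fixes M :: "('k, 'e) module" and N :: "('k, 'f) module"
  assumes "vectorspace K M" "vectorspace K N" "carrier N = {\<zero>\<^bsub>N\<^esub>}" "f \<in> carrier M \<rightarrow> carrier N"
  shows "linear_map K M N f"
proof -
  interpret M: vectorspace K M by fact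
  interpret N: vectorspace K N by fact
  have f: "f x = \<zero>\<^bsub>N\<^esub>" if "x \<in> carrier M" for x
    using assms(3,4) that by auto
  have "f \<in> LinearCombinations.module_hom K M N"
    by (simp add: LinearCombinations.module_hom_def f)
  then show ?thesis
    by (intro linear_map.intro mod_hom.intro mod_hom_axioms.intro) unfold_locales
qed

lemma linear_map_cong:
  fixes M M' :: "('k, 'e) module" and N N' :: "('k, 'f) module"
  assumes "linear_map K M N f" "vectorspace K M'" "vectorspace K N'"
    and "carrier M' = carrier M" "carrier N' = carrier N"
    and "\<And>x y. x \<in> carrier M \<Longrightarrow> y \<in> carrier M \<Longrightarrow> x \<oplus>\<^bsub>M'\<^esub> y = x \<oplus>\<^bsub>M\<^esub> y"
    and "\<And>c x. c \<in> carrier K \<Longrightarrow> x \<in> carrier M \<Longrightarrow> c \<odot>\<^bsub>M'\<^esub> x = c \<odot>\<^bsub>M\<^esub> x"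
    and "\<And>x y. x \<in> carrier N \<Longrightarrow> y \<in> carrier N \<Longrightarrow> x \<oplus>\<^bsub>N'\<^esub> y = x \<oplus>\<^bsub>N\<^esub> y"
    and "\<And>c x. c \<in> carrier K \<Longrightarrow> x \<in> carrier N \<Longrightarrow> c \<odot>\<^bsub>N'\<^esub> x = c \<odot>\<^bsub>N\<^esub> x"
    and "\<And>x. x \<in> carrier M \<Longrightarrow> g x = f x"
  shows "linear_map K M' N' g"
proof -
  interpret f: linear_map K M N f by fact
  interpret M': vectorspace K M' by fact
  interpret N': vectorspace K N' by fact
  have "g \<in> LinearCombinations.module_hom K M' N'"
    using assms(4-) f.f_hom by (auto simp: LinearCombinations.module_hom_def Pi_def)
  then show ?thesis
    by (intro linear_map.intro mod_hom.intro mod_hom_axioms.intro) unfold_locales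
qed


section \<open>Thin representations of the linear quiver\<close>

text \<open>Formulated by a basis vector and its multiples: this yields coordinates directly and
  carries over unchanged to the quotient by zero.\<close>

definition one_dim :: "('k :: field, 'e) module \<Rightarrow> bool" where
  "one_dim M \<longleftrightarrow> (\<exists>e\<in>carrier M. bij_betw (\<lambda>c. c \<odot>\<^bsub>M\<^esub> e) UNIV (carrier M))"

text \<open>An abstract form of \<open>M\<^sub>b\<close>, with injective maps in place of
  identities. Quotients built on coset representatives satisfy it without being literally
  \<open>M\<^sub>b\<close>, so projections can be iterated.\<close>

definition thin_rep :: "nat \<Rightarrow> nat \<Rightarrow> (nat, nat, 'k :: field, 'e) rep \<Rightarrow> bool" where
  "thin_rep n b V \<longleftrightarrow> b \<le> n \<and>
     (\<forall>i\<in>{1..n}. vectorspace class_ring (space V i) \<and>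
        (if i \<le> b then one_dim (space V i) else carrier (space V i) = {\<zero>\<^bsub>space V i\<^esub>})) \<and>
     (\<forall>i\<in>{1..<n}. linear_map class_ring (space V i) (space V (Suc i)) (rep_map V i) \<and>
        (i < b \<longrightarrow> inj_on (rep_map V i) (carrier (space V i))))"

lemma linear_quiver_simps [simp]:
  "verts (linear_quiver n) = {1..n}" "arcs (linear_quiver n) = {1..<n}"
  "tail (linear_quiver n) i = i" "head (linear_quiver n) i = Suc i"
  by (simp_all add: linear_quiver_def)

lemma rep_isomorphic_bij:
  assumes "rep_isomorphic Q V W" "i \<in> verts Q"
  shows "\<exists>\<phi>. bij_betw \<phi> (carrier (space V i)) (carrier (space W i))"
  using assms unfolding rep_isomorphic_def by blast

lemma subspace_zero:
  fixes M :: "('k, 'e) module"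
  assumes "vectorspace K M"
  shows "VectorSpace.subspace K {\<zero>\<^bsub>M\<^esub>} M"
proof -
  interpret vectorspace K M by fact
  show ?thesis
    by (intro subspace.intro LinearCombinations.submodule.intro)
      (simp_all add: vectorspace_axioms module_axioms)
qed

lemma subspace_carrier:
  fixes M :: "('k, 'e) module"
  assumes "vectorspace K M"
  shows "VectorSpace.subspace K (carrier M) M"
proof -
  interpret vectorspace K M by fact
  show ?thesis
    by (intro subspace.intro LinearCombinations.submodule.intro)
      (simp_all add: vectorspace_axioms module_axioms)
qed

text \<open>A vector goes to the one-tuple of its coordinate. Preservation of zero is recorded for
  the compatibility with arrows in the torsion computation.\<close>

lemma one_dim_iso_copies:
  fixes M :: "('k :: field, 'e) module" and t :: 'v
  assumes "vectorspace class_ring M" "one_dim M"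
  defines "N \<equiv> space (rep_copies (Suc 0) (simple_rep t) :: ('v, 'a, 'k, nat \<Rightarrow> 'k) rep) t"
  obtains f where "f \<in> LinearCombinations.module_hom class_ring M N"
    "bij_betw f (carrier M) (carrier N)" "f \<zero>\<^bsub>M\<^esub> = \<zero>\<^bsub>N\<^esub>"
proof -
  interpret vectorspace class_ring M by fact
  obtain e where e: "e \<in> carrier M" and bij: "bij_betw (\<lambda>c. c \<odot>\<^bsub>M\<^esub> e) UNIV (carrier M)"
    using assms(2) by (auto simp: one_dim_def)
  define coord where "coord = the_inv_into UNIV (\<lambda>c. c \<odot>\<^bsub>M\<^esub> e)"
  have coord_smult: "coord (c \<odot>\<^bsub>M\<^esub> e) = c" for c
    using the_inv_into_f_f[of "\<lambda>c. c \<odot>\<^bsub>M\<^esub> e" UNIV c] bij by (simp add: coord_def bij_betw_def)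
  have smult_coord: "coord x \<odot>\<^bsub>M\<^esub> e = x" if x: "x \<in> carrier M" for x
  proof -
    obtain c where "x = c \<odot>\<^bsub>M\<^esub> e"
      using bij x by (auto simp: bij_betw_def)
    then show ?thesis by (simp add: coord_smult)
  qed
  have smult_closed': "c \<odot>\<^bsub>M\<^esub> e \<in> carrier M" for c
    using e by simp
  have coord_add: "coord (x \<oplus>\<^bsub>M\<^esub> y) = coord x + coord y"
    if "x \<in> carrier M" "y \<in> carrier M" for x y
  proof -
    have "(coord x + coord y) \<odot>\<^bsub>M\<^esub> e = x \<oplus>\<^bsub>M\<^esub> y"
      using smult_l_distr[of "coord x" "coord y" e] e by (simp add: smult_coord that)
    then show ?thesis
      using coord_smult[of "coord x + coord y"] by metis
  qed
  have coord_mult: "coord (c \<odot>\<^bsub>M\<^esub> x) = c * coord x" if "x \<in> carrier M" for c x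
  proof -
    have "(c * coord x) \<odot>\<^bsub>M\<^esub> e = c \<odot>\<^bsub>M\<^esub> x"
      using smult_assoc1[of c "coord x" e] e by (simp add: smult_coord that)
    then show ?thesis
      using coord_smult[of "c * coord x"] by metis
  qed
  have "0 \<odot>\<^bsub>M\<^esub> e = \<zero>\<^bsub>M\<^esub>"
    using smult_l_null[OF e] by simp
  then have coord_zero: "coord \<zero>\<^bsub>M\<^esub> = 0"
    using coord_smult[of 0] by simp
  define f where "f = (\<lambda>x. \<lambda>j\<in>{..<Suc 0}. coord x)"
  have N: "carrier N = {..<Suc 0} \<rightarrow>\<^sub>E UNIV" "\<zero>\<^bsub>N\<^esub> = (\<lambda>j\<in>{..<Suc 0}. 0)"
    "\<And>g h. g \<oplus>\<^bsub>N\<^esub> h = (\<lambda>j\<in>{..<Suc 0}. g j + h j)"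
    "\<And>c g. c \<odot>\<^bsub>N\<^esub> g = (\<lambda>j\<in>{..<Suc 0}. c * g j)"
    by (simp_all add: N_def rep_copies_def simple_rep_def)
  have f_closed: "f x \<in> carrier N" for x
    by (simp add: N f_def)
  have f_add: "f (x \<oplus>\<^bsub>M\<^esub> y) = f x \<oplus>\<^bsub>N\<^esub> f y" if "x \<in> carrier M" "y \<in> carrier M" for x y
    unfolding N f_def by (rule restrict_ext) (simp add: coord_add that)
  have f_smult: "f (c \<odot>\<^bsub>M\<^esub> x) = c \<odot>\<^bsub>N\<^esub> f x" if "x \<in> carrier M" for c x
    unfolding N f_def by (rule restrict_ext) (simp add: coord_mult that)
  show thesis
  proof
    show "f \<in> LinearCombinations.module_hom class_ring M N"
      unfolding LinearCombinations.module_hom_def using f_closed f_add f_smult by blast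
    show "bij_betw f (carrier M) (carrier N)"
    proof (rule bij_betw_byWitness[where f' = "\<lambda>g. g 0 \<odot>\<^bsub>M\<^esub> e"])
      show "\<forall>x\<in>carrier M. f x 0 \<odot>\<^bsub>M\<^esub> e = x"
        by (simp add: f_def smult_coord)
      show "\<forall>g\<in>carrier N. f (g 0 \<odot>\<^bsub>M\<^esub> e) = g"
      proof
        fix g assume "g \<in> carrier N"
        then have "g \<in> extensional {..<Suc 0}"
          by (simp add: N PiE_def)
        then show "f (g 0 \<odot>\<^bsub>M\<^esub> e) = g"
          by (intro extensionalityI[of _ "{..<Suc 0}"]) (simp_all add: f_def coord_smult)
      qed
      show "f ` carrier M \<subseteq> carrier N"
        using f_closed by blast
      show "(\<lambda>g. g 0 \<odot>\<^bsub>M\<^esub> e) ` carrier N \<subseteq> carrier M"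
        using smult_closed' by blast
    qed
    show "f \<zero>\<^bsub>M\<^esub> = \<zero>\<^bsub>N\<^esub>"
      unfolding N f_def coord_zero ..
  qed
qed

text \<open>If \<open>i \<noteq> t\<close> the simple representation vanishes at \<open>i\<close>;
  if \<open>m = 0\<close> there is only the function on the empty index set. Either way the target
  has one element.\<close>

lemma trivial_iso_copies:
  fixes M :: "('k :: field, 'e) module" and i t :: 'v and m :: nat
  assumes "vectorspace class_ring M" "carrier M = {\<zero>\<^bsub>M\<^esub>}" "i \<noteq> t \<or> m = 0"
  defines "N \<equiv> space (rep_copies m (simple_rep t) :: ('v, 'a, 'k, nat \<Rightarrow> 'k) rep) i"
  shows "(\<lambda>x. \<zero>\<^bsub>N\<^esub>) \<in> LinearCombinations.module_hom class_ring M N"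
    and "bij_betw (\<lambda>x. \<zero>\<^bsub>N\<^esub>) (carrier M) (carrier N)"
proof -
  have zero: "\<zero>\<^bsub>N\<^esub> = (\<lambda>j\<in>{..<m}. 0)"
    by (simp add: N_def rep_copies_def simple_rep_def)
  have carr: "carrier N = {\<zero>\<^bsub>N\<^esub>}"
    using assms(3) unfolding zero
    by (auto simp: N_def rep_copies_def simple_rep_def fun_eq_iff PiE_def Pi_def extensional_def)
  show "(\<lambda>x. \<zero>\<^bsub>N\<^esub>) \<in> LinearCombinations.module_hom class_ring M N"
    by (auto simp: LinearCombinations.module_hom_def carr)
      (auto simp: N_def rep_copies_def simple_rep_def)
  show "bij_betw (\<lambda>x. \<zero>\<^bsub>N\<^esub>) (carrier M) (carrier N)"
    by (simp add: assms(2) carr bij_betw_def)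
qed

section \<open>Torsion and projection of thin representations\<close>

text \<open>A submodule concentrated at \<open>t\<close> is killed by the arrow leaving
  \<open>t\<close>. Below \<open>b\<close> that arrow acts injectively and above \<open>b\<close>
  the space is zero, so only \<open>t = b\<close> leaves room for a copy of the simple.\<close>

lemma torsion_thin_rep:
  fixes V :: "(nat, nat, 'k :: field, 'e) rep"
  assumes V: "thin_rep n b V" and t: "t \<in> {1..n}"
  shows "torsion (linear_quiver n) t V =
    (\<lambda>i. if i \<notin> {1..n} then {}
         else if i = t \<and> i = b then carrier (space V i) else {\<zero>\<^bsub>space V i\<^esub>})"
    (is "_ = ?U")
proof -
  let ?Q = "linear_quiver n"
  have vs: "vectorspace class_ring (space V i)" if "i \<in> {1..n}" for i
    using V that by (simp add: thin_rep_def)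
  have lin: "linear_map class_ring (space V i) (space V (Suc i)) (rep_map V i)"
    if "i \<in> {1..<n}" for i
    using V that by (simp add: thin_rep_def)
  have map_zero: "rep_map V i \<zero>\<^bsub>space V i\<^esub> = \<zero>\<^bsub>space V (Suc i)\<^esub>" if "i \<in> {1..<n}" for i
  proof -
    interpret linear_map class_ring "space V i" "space V (Suc i)" "rep_map V i"
      using that by (rule lin)
    show ?thesis by (rule f0_is_0)
  qed
  have map_closed: "rep_map V i x \<in> carrier (space V (Suc i))"
    if "i \<in> {1..<n}" "x \<in> carrier (space V i)" for i x
  proof -
    interpret linear_map class_ring "space V i" "space V (Suc i)" "rep_map V i"
      using that(1) by (rule lin)
    show ?thesis using that(2) by simp
  qed
  have zero_closed: "\<zero>\<^bsub>space V i\<^esub> \<in> carrier (space V i)" if "i \<in> {1..n}" for i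
  proof -
    interpret vectorspace class_ring "space V i" using that by (rule vs)
    show ?thesis by simp
  qed
  have trivial: "carrier (space V i) = {\<zero>\<^bsub>space V i\<^esub>}" if "i \<in> {1..n}" "b < i" for i
    using V that by (simp add: thin_rep_def)
  have sub: "subrep ?Q V ?U"
    unfolding subrep_def
  proof (intro conjI ballI allI impI)
    fix i assume "i \<in> verts ?Q"
    then show "VectorSpace.subspace class_ring (?U i) (space V i)"
      using vs by (auto intro: subspace_zero subspace_carrier)
  next
    fix a assume a: "a \<in> arcs ?Q"
    then have "a \<in> {1..<n}" "a \<in> {1..n}" "Suc a \<in> {1..n}" by auto
    then show "rep_map V a ` ?U (tail ?Q a) \<subseteq> ?U (head ?Q a)"
      using map_zero[of a] map_closed[of a] zero_closed[of "Suc a"] trivial[of "Suc a"]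
      by auto
  qed auto
  have iso: "\<exists>m. rep_isomorphic ?Q (rep_of_subrep V ?U) (rep_copies m (simple_rep t))"
  proof -
    \<comment> \<open>The torsion part is one copy of the simple at the socle vertex
      \<open>b\<close>, and the empty sum for every other \<open>t\<close>.\<close>
    define m :: nat where "m = (if t = b then 1 else 0)"
    let ?W = "rep_copies m (simple_rep t) :: (nat, nat, 'k, nat \<Rightarrow> 'k) rep"
    let ?M = "\<lambda>i. space (rep_of_subrep V ?U) i"
    define good where "good i f \<longleftrightarrow>
        f \<in> LinearCombinations.module_hom class_ring (?M i) (space ?W i) \<and>
        bij_betw f (carrier (?M i)) (carrier (space ?W i)) \<and> f \<zero>\<^bsub>?M i\<^esub> = \<zero>\<^bsub>space ?W i\<^esub>" for i f
    have "\<exists>f. good i f" if i: "i \<in> {1..n}" for i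
    proof (cases "i = t \<and> i = b")
      case True
      then have "one_dim (space V i)"
        using V i by (simp add: thin_rep_def)
      moreover have "?M i = space V i"
        using True i by (simp add: rep_of_subrep_def)
      ultimately show ?thesis
        using one_dim_iso_copies[OF vs[OF i], of t] True unfolding good_def
        by (auto simp: m_def)
    next
      case False
      have M: "?M i = (space V i)\<lparr>carrier := {\<zero>\<^bsub>space V i\<^esub>}\<rparr>"
        using False i by (auto simp: rep_of_subrep_def)
      interpret vectorspace class_ring "space V i" using i by (rule vs)
      have "vectorspace class_ring (?M i)"
        unfolding M by (intro trivial_vectorspace class_field) auto
      moreover have "carrier (?M i) = {\<zero>\<^bsub>?M i\<^esub>}"
        unfolding M by simp
      moreover have "i \<noteq> t \<or> m = 0"
        using False by (auto simp: m_def)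
      ultimately show ?thesis
        using trivial_iso_copies[of "?M i" i t m] unfolding good_def by blast
    qed
    then obtain \<phi> where \<phi>: "\<And>i. i \<in> {1..n} \<Longrightarrow> good i (\<phi> i)"
      by metis
    have "\<phi> (Suc a) (rep_map V a x) = rep_map ?W a (\<phi> a x)"
      if a: "a \<in> {1..<n}" and x: "x \<in> ?U a" for a x
    proof -
      \<comment> \<open>Arrows vanish on \<open>?U\<close>: either \<open>x\<close> is zero, or
        \<open>a = b\<close> and the target space is zero. Compatibility thus reduces to zero being
        sent to zero.\<close>
      have "rep_map V a x = \<zero>\<^bsub>space V (Suc a)\<^esub>"
        using a x map_zero[OF a] map_closed[OF a, of x] trivial[of "Suc a"]
        by (auto split: if_splits)
      moreover have "\<phi> (Suc a) \<zero>\<^bsub>space V (Suc a)\<^esub> = \<zero>\<^bsub>space ?W (Suc a)\<^esub>"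
        using \<phi>[of "Suc a"] a by (simp add: good_def rep_of_subrep_def)
      ultimately show ?thesis
        by (simp add: rep_copies_def simple_rep_def)
    qed
    then have "\<forall>a\<in>arcs ?Q. \<forall>x\<in>carrier (?M (tail ?Q a)).
        \<phi> (head ?Q a) (rep_map (rep_of_subrep V ?U) a x) = rep_map ?W a (\<phi> (tail ?Q a) x)"
      by (simp add: rep_of_subrep_def)
    then have "rep_isomorphic ?Q (rep_of_subrep V ?U) ?W"
      unfolding rep_isomorphic_def using \<phi> by (intro exI[of _ \<phi>]) (simp add: good_def)
    then show ?thesis by blast
  qed
  have max: "U \<le> ?U"
    if U: "subrep ?Q V U"
      and iso: "rep_isomorphic ?Q (rep_of_subrep V U) (rep_copies m (simple_rep t))" for U m
  proof -
    have subsp: "VectorSpace.subspace class_ring (U i) (space V i)" if "i \<in> {1..n}" for i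
      using U that by (simp add: subrep_def)
    have incl: "U i \<subseteq> carrier (space V i)" and zero: "\<zero>\<^bsub>space V i\<^esub> \<in> U i" if "i \<in> {1..n}" for i
    proof -
      interpret subspace class_ring "U i" "space V i" using that by (rule subsp)
      interpret LinearCombinations.submodule class_ring "U i" "space V i" by (rule submod)
      show "U i \<subseteq> carrier (space V i)" "\<zero>\<^bsub>space V i\<^esub> \<in> U i"
        by (rule subset, rule zero_closed)
    qed
    \<comment> \<open>Away from \<open>t\<close> the sum of copies has a single element, so
      injectivity of the isomorphism leaves only zero.\<close>
    have other: "U i = {\<zero>\<^bsub>space V i\<^esub>}" if i: "i \<in> {1..n}" "i \<noteq> t" for i
    proof -
      obtain \<phi> where "bij_betw \<phi> (U i) ({..<m} \<rightarrow>\<^sub>E {0 :: 'k})"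
        using rep_isomorphic_bij[OF iso, of i] i
        by (auto simp: rep_of_subrep_def rep_copies_def simple_rep_def)
      then have "inj_on \<phi> (U i)" "\<phi> ` U i = {\<lambda>j\<in>{..<m}. 0}"
        by (auto simp: bij_betw_def PiE_eq_singleton restrict_def)
      then have "\<phi> x = \<phi> \<zero>\<^bsub>space V i\<^esub>" if "x \<in> U i" for x
        using that zero[OF i(1)] by (metis imageI singletonD)
      then show ?thesis
        using zero[OF i(1)] \<open>inj_on \<phi> (U i)\<close> by (blast dest: inj_onD)
    qed
    show ?thesis
    proof (rule le_funI)
      fix i
      consider "i \<notin> {1..n}" | "i \<in> {1..n}" "i \<noteq> t" | "i \<in> {1..n}" "i = t" "i = b"
        | "i \<in> {1..n}" "b < i" | "i \<in> {1..n}" "i = t" "i < b"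
        by linarith
      then show "U i \<le> ?U i"
      proof cases
        case 1
        then show ?thesis using U by (simp add: subrep_def)
      next
        case 2
        then show ?thesis using other by auto
      next
        case 3
        then show ?thesis using incl by auto
      next
        case 4
        then show ?thesis using incl[of i] trivial[of i] by auto
      next
        case 5
        \<comment> \<open>From \<open>i < b \<le> n\<close> there is an arrow leaving
          \<open>i\<close>. Its target \<open>Suc i\<close> is not \<open>t\<close>, where
          \<open>U\<close> is zero, so \<open>U i\<close> lies in the kernel of an injective
          map.\<close>
        then have a: "i \<in> {1..<n}"
          using V by (auto simp: thin_rep_def)
        have "rep_map V i ` U i \<subseteq> U (Suc i)"
          using U a by (fastforce simp: subrep_def)
        then have "rep_map V i x = \<zero>\<^bsub>space V (Suc i)\<^esub>" if "x \<in> U i" for x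
          using that other[of "Suc i"] a 5 by auto
        moreover have "inj_on (rep_map V i) (carrier (space V i))"
          using V a 5 by (simp add: thin_rep_def)
        ultimately have "x = \<zero>\<^bsub>space V i\<^esub>" if "x \<in> U i" for x
          using that map_zero[OF a] incl[OF 5(1)] zero_closed[OF 5(1)]
          by (metis inj_onD subsetD)
        then have "U i \<subseteq> {\<zero>\<^bsub>space V i\<^esub>}" by blast
        then show ?thesis using 5 by simp
      qed
    qed
  qed
  show ?thesis
    unfolding torsion_def by (rule Greatest_equality) (use sub iso max in auto)
qed

text \<open>Every vertex space is divided by zero, except that for \<open>t = b\<close> the space at
  \<open>b\<close> is divided by itself. So \<open>b\<close> drops by one if \<open>t = b\<close>
  and stays otherwise.\<close>

lemma thin_rep_proj_functor:
  fixes V :: "(nat, nat, 'k :: field, 'e) rep"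
  assumes V: "thin_rep n b V" and t: "t \<in> {1..n}"
  shows "thin_rep n (shift t b) (proj_functor (linear_quiver n) t V)"
proof -
  let ?P = "proj_functor (linear_quiver n) t V"
  have b: "b \<le> n" and vs: "\<And>i. i \<in> {1..n} \<Longrightarrow> vectorspace class_ring (space V i)"
    and dim: "\<And>i. i \<in> {1..n} \<Longrightarrow> i \<le> b \<Longrightarrow> one_dim (space V i)"
    and trivial: "\<And>i. i \<in> {1..n} \<Longrightarrow> b < i \<Longrightarrow> carrier (space V i) = {\<zero>\<^bsub>space V i\<^esub>}"
    and lin: "\<And>i. i \<in> {1..<n} \<Longrightarrow>
      linear_map class_ring (space V i) (space V (Suc i)) (rep_map V i)"
    and inj: "\<And>i. i \<in> {1..<n} \<Longrightarrow> i < b \<Longrightarrow> inj_on (rep_map V i) (carrier (space V i))"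
    using V by (simp_all add: thin_rep_def)
  have cut: "space ?P i = quot_space (space V i) (carrier (space V i))"
    if "i \<in> {1..n}" "i = t" "i = b" for i
    using that by (simp add: proj_functor_def quot_rep_def torsion_thin_rep[OF V t])
  have keep: "space ?P i = quot_space (space V i) {\<zero>\<^bsub>space V i\<^esub>}"
    if "i \<in> {1..n}" "\<not> (i = t \<and> i = b)" for i
    using that by (auto simp: proj_functor_def quot_rep_def torsion_thin_rep[OF V t])
  have vs': "vectorspace class_ring (space ?P i)" if "i \<in> {1..n}" for i
    using quot_space_zero(5)[OF vs[OF that]] quot_space_carrier(2)[OF vs[OF that]] cut[OF that] keep[OF that]
    by (cases "i = t \<and> i = b") simp_all
  have map_closed: "rep_map V i x \<in> carrier (space V (Suc i))"
    if "i \<in> {1..<n}" "x \<in> carrier (space V i)" for i x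
  proof -
    interpret linear_map class_ring "space V i" "space V (Suc i)" "rep_map V i"
      using that(1) by (rule lin)
    show ?thesis using that(2) by simp
  qed
  have map_eq: "rep_map ?P i x = rep_map V i x"
    if "i \<in> {1..<n}" "\<not> (Suc i = t \<and> Suc i = b)" "x \<in> carrier (space V i)" for i x
  proof -
    interpret vectorspace class_ring "space V (Suc i)"
      using that(1) by (intro vs) auto
    have "coset_rep (space V (Suc i)) {\<zero>\<^bsub>space V (Suc i)\<^esub>} (rep_map V i x) = rep_map V i x"
      using that by (intro coset_rep_zero map_closed) unfold_locales
    then show ?thesis
      using that by (auto simp: proj_functor_def quot_rep_def torsion_thin_rep[OF V t])
  qed
  have trivial': "carrier (space ?P i) = {\<zero>\<^bsub>space ?P i\<^esub>}" if "i \<in> {1..n}" "shift t b < i" for i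
  proof (cases "i = t \<and> i = b")
    case True
    then show ?thesis
      using that quot_space_carrier(1)[OF vs, of i] by (simp add: cut)
  next
    case False
    then have "b < i"
      using that by (auto simp: shift_def split: if_splits)
    then show ?thesis
      using that False quot_space_zero(1,2)[OF vs, of i] trivial[of i] by (simp add: keep)
  qed
  have dim': "one_dim (space ?P i)" if i: "i \<in> {1..n}" "i \<le> shift t b" for i
  proof -
    have ib: "i \<le> b" "\<not> (i = t \<and> i = b)"
      using i by (auto simp: shift_def split: if_splits)
    note q = quot_space_zero[OF vs[OF i(1)]]
    obtain e where e: "e \<in> carrier (space V i)"
      "bij_betw (\<lambda>c. c \<odot>\<^bsub>space V i\<^esub> e) UNIV (carrier (space V i))"
      using dim[OF i(1) ib(1)] by (auto simp: one_dim_def)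
    then show ?thesis
      unfolding one_dim_def keep[OF i(1) ib(2)]
      by (intro bexI[of _ e]) (simp_all add: q(1,4))
  qed
  have lin': "linear_map class_ring (space ?P i) (space ?P (Suc i)) (rep_map ?P i)"
    if i: "i \<in> {1..<n}" for i
  proof -
    have i1: "i \<in> {1..n}" "Suc i \<in> {1..n}"
      using i by auto
    show ?thesis
    \<comment> \<open>In this case the target is zero after the quotient, even if the source was cut
      as well. Otherwise neither end of the arrow is cut and the map agrees with the old
      one.\<close>
    proof (cases "t = b \<and> b \<le> Suc i")
      case True
      then have "carrier (space ?P (Suc i)) = {\<zero>\<^bsub>space ?P (Suc i)\<^esub>}"
        using i1 t by (intro trivial') (auto simp: shift_def)
      moreover have "rep_map ?P i x \<in> carrier (space ?P (Suc i))"
        if x: "x \<in> carrier (space ?P i)" for x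
      proof -
        have "x \<in> carrier (space V i)"
          using x quot_space_zero(1)[OF vs[OF i1(1)]] quot_space_carrier(3)[OF vs[OF i1(1)]]
            cut[OF i1(1)] keep[OF i1(1)] by (cases "i = t \<and> i = b") auto
        then show ?thesis
          using map_closed[OF i] by (auto simp: proj_functor_def quot_rep_def quot_space_def)
      qed
      ultimately show ?thesis
        using i1 by (intro linear_map_into_trivial vs') auto
    next
      case False
      then have *: "\<not> (i = t \<and> i = b)" "\<not> (Suc i = t \<and> Suc i = b)" by auto
      show ?thesis
        using quot_space_zero[OF vs[OF i1(1)]] quot_space_zero[OF vs[OF i1(2)]] map_eq[OF i *(2)]
        by (intro linear_map_cong[OF lin[OF i]] vs' i1) (simp_all add: keep[OF i1(1) *(1)] keep[OF i1(2) *(2)])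
    qed
  qed
  have inj': "inj_on (rep_map ?P i) (carrier (space ?P i))" if i: "i \<in> {1..<n}" "i < shift t b" for i
  proof -
    have *: "\<not> (i = t \<and> i = b)" "\<not> (Suc i = t \<and> Suc i = b)" "i < b" "i \<in> {1..n}"
      using i by (auto simp: shift_def split: if_splits)
    have "carrier (space ?P i) = carrier (space V i)"
      using quot_space_zero(1)[OF vs[OF *(4)]] by (simp add: keep[OF *(4,1)])
    then show ?thesis
      using inj[OF i(1) *(3)] map_eq[OF i(1) *(2)] by (simp add: inj_on_def)
  qed
  show ?thesis
    unfolding thin_rep_def
    using b vs' dim' trivial' lin' inj' by (auto simp: shift_def not_le)
qed

section \<open>Separating words by thin representations\<close>

text \<open>A field has \<open>0 \<noteq> 1\<close>, and \<open>card\<close> is 0 on infinite sets,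
  so the comparison with 1 serves finite and infinite fields alike.\<close>

lemma card_one_dim: "one_dim (M :: ('k :: field, 'e) module) \<Longrightarrow> card (carrier M) \<noteq> 1"
proof
  assume "one_dim M" "card (carrier M) = 1"
  then have "card (UNIV :: 'k set) = 1"
    by (auto simp: one_dim_def dest: bij_betw_same_card)
  then obtain x :: 'k where "UNIV = {x}"
    by (rule card_1_singletonE)
  then have "(0 :: 'k) = 1"
    by (metis UNIV_I singletonD)
  then show False by simp
qed

text \<open>If \<open>b \<noteq> c\<close>, then at the vertex \<open>max b c\<close> one space is a
  line and the other is zero, and cardinality 1 tells them apart.\<close>

lemma thin_rep_isomorphic_imp_eq:
  assumes V: "thin_rep n b V" and W: "thin_rep n c W"
    and iso: "rep_isomorphic (linear_quiver n) V W"
  shows "b = c"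
proof (rule ccontr)
  assume "b \<noteq> c"
  define i where "i = max b c"
  have i: "i \<in> {1..n}"
    using V W \<open>b \<noteq> c\<close> by (auto simp: i_def thin_rep_def)
  obtain \<phi> where "bij_betw \<phi> (carrier (space V i)) (carrier (space W i))"
    using rep_isomorphic_bij[OF iso, of i] i by auto
  then have card: "card (carrier (space V i)) = card (carrier (space W i))"
    by (rule bij_betw_same_card)
  have "card (carrier (space V i)) = 1 \<longleftrightarrow> b < i"
    using V i card_one_dim[of "space V i"] by (cases "i \<le> b") (auto simp: thin_rep_def)
  moreover have "card (carrier (space W i)) = 1 \<longleftrightarrow> c < i"
    using W i card_one_dim[of "space W i"] by (cases "i \<le> c") (auto simp: thin_rep_def)
  ultimately show False
    using card \<open>b \<noteq> c\<close> by (auto simp: i_def)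
qed

text \<open>The representation \<open>M\<^sub>b\<close>. Scalars are encoded as constant functions
  because \<open>admissible_normal_form\<close> prescribes the element type
  \<open>nat \<Rightarrow> 'k\<close>.\<close>

definition interval_rep :: "nat \<Rightarrow> (nat, nat, 'k :: field, nat \<Rightarrow> 'k) rep" where
  "interval_rep b =
    \<lparr>space = (\<lambda>i. \<lparr>carrier = (if i \<le> b then range (\<lambda>c x. c) else {\<lambda>x. 0}),
                   mult = undefined, one = undefined, zero = (\<lambda>x. 0),
                   add = (\<lambda>f g x. f x + g x), smult = (\<lambda>c f x. c * f x)\<rparr>),
     rep_map = (\<lambda>a f. if a < b then f else (\<lambda>x. 0))\<rparr>"

lemma thin_rep_interval_rep:
  assumes "b \<le> n"
  shows "thin_rep n b (interval_rep b :: (nat, nat, 'k :: field, nat \<Rightarrow> 'k) rep)"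
proof -
  let ?V = "interval_rep b :: (nat, nat, 'k, nat \<Rightarrow> 'k) rep"
  have vs: "vectorspace class_ring (space ?V i)" for i
  proof (rule vectorspaceI)
    show "\<exists>y\<in>carrier (space ?V i). y \<oplus>\<^bsub>space ?V i\<^esub> x = \<zero>\<^bsub>space ?V i\<^esub>"
      if "x \<in> carrier (space ?V i)" for x
      using that by (intro bexI[of _ "\<lambda>j. - x j"]) (auto simp: interval_rep_def split: if_splits)
  qed (auto simp: interval_rep_def class_field algebra_simps split: if_splits)
  have "one_dim (space ?V i)" if "i \<le> b" for i
    unfolding one_dim_def
    using that by (intro bexI[of _ "\<lambda>x. 1"]) (auto simp: interval_rep_def bij_betw_def inj_on_def fun_eq_iff)
  moreover have "linear_map class_ring (space ?V i) (space ?V (Suc i)) (rep_map ?V i)" for i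
  proof -
    have "rep_map ?V i \<in> LinearCombinations.module_hom class_ring (space ?V i) (space ?V (Suc i))"
      by (auto simp: LinearCombinations.module_hom_def interval_rep_def)
    then show ?thesis
      using vs[of i] vs[of "Suc i"]
      by (intro linear_map.intro mod_hom.intro mod_hom_axioms.intro) (auto intro: vectorspace.axioms)
  qed
  ultimately show ?thesis
    using assms vs by (auto simp: thin_rep_def) (auto simp: interval_rep_def)
qed

lemma fin_dim_rep_thin_rep:
  fixes V :: "(nat, nat, 'k :: field, 'e) rep"
  assumes V: "thin_rep n b V"
  shows "fin_dim_rep (linear_quiver n) V"
proof -
  have "vectorspace.fin_dim class_ring (space V i)" if i: "i \<in> {1..n}" for i
  proof -
    interpret vectorspace class_ring "space V i"
      using V i by (simp add: thin_rep_def)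
    obtain e where e: "e \<in> carrier (space V i)" "carrier (space V i) \<subseteq> range (\<lambda>c. c \<odot>\<^bsub>space V i\<^esub> e)"
    proof (cases "i \<le> b")
      case True
      then have "one_dim (space V i)"
        using V i by (simp add: thin_rep_def)
      then show thesis
        using that by (auto simp: one_dim_def bij_betw_def)
    next
      case False
      then show thesis
        using V i that[of "\<zero>\<^bsub>space V i\<^esub>"] by (auto simp: thin_rep_def image_iff intro: exI[of _ 0])
    qed
    interpret S: LinearCombinations.submodule class_ring "span {e}" "space V i"
      using e(1) by (intro span_is_submodule) simp
    have "e \<in> span {e}"
      using in_own_span[of "{e}"] e(1) by simp
    then have "carrier (space V i) \<subseteq> span {e}"
      using e(2) S.smult_closed by auto
    then have "span {e} = carrier (space V i)"
      using span_is_subset2[of "{e}"] e(1) by auto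
    then show ?thesis
      unfolding fin_dim_def using e(1) by (intro exI[of _ "{e}"]) simp
  qed
  then show ?thesis
    using V by (simp add: fin_dim_rep_def thin_rep_def)
qed

text \<open>Both folds let the last letter of the word act first, so the action on indices follows
  the composite functor.\<close>

lemma thin_rep_proj_word:
  assumes "thin_rep n b V" "set w \<subseteq> {1..n}"
  shows "thin_rep n (foldr shift w b) (proj_word (linear_quiver n) w V)"
  using assms(2) by (induction w) (simp_all add: assms(1) proj_word_def thin_rep_proj_functor)


section \<open>The normal form\<close>

lemma finite_acyclic_linear_quiver: "finite_acyclic_quiver (linear_quiver n)"
proof -
  have "fin_digraph (linear_quiver n)"
    by unfold_locales auto
  moreover have "arcs_ends (linear_quiver n) \<subseteq> {(x, y). x < y}"
    by (auto simp: arcs_ends_conv)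
  then have "acyclic (arcs_ends (linear_quiver n))"
    using acyclic_subset[OF wf_acyclic[OF wf_less]] by blast
  ultimately show ?thesis
    by (simp add: finite_acyclic_quiver_def)
qed

text \<open>
  Words with a foreign letter are sent to \<open>None\<close>, so that the congruence law of
  \<^locale>\<open>catalan_presentation\<close> needs no side condition on the letters.
\<close>

lemma catalan_presentation_B_word:
  "catalan_presentation (\<lambda>w. if w \<in> lists {1..n}
     then Some (B_word (linear_quiver n) w :: (nat list \<Rightarrow> 'k :: field) set) else None) n"
proof unfold_locales
  let ?Q = "linear_quiver n"
  let ?B = "B_word ?Q :: nat list \<Rightarrow> (nat list \<Rightarrow> 'k) set"
  let ?F = "\<lambda>w. if w \<in> lists {1..n} then Some (?B w) else None"
  have arrow: "(s, t) \<in> arcs_ends ?Q \<Longrightarrow> t = Suc s" for s t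
    by (auto simp: arcs_ends_conv)
  show "?F (u @ v) = ?F (u' @ v')" if eq: "?F u = ?F u'" "?F v = ?F v'" for u u' v v'
  proof (cases "u @ v \<in> lists {1..n}")
    case True
    then have "u \<in> lists {1..n}" "v \<in> lists {1..n}" by auto
    moreover from this have "u' \<in> lists {1..n}" "v' \<in> lists {1..n}" "?B u = ?B u'" "?B v = ?B v'"
      using eq by (auto split: if_splits)
    ultimately have "?B (u @ v) = ?B (u' @ v')" "u' @ v' \<in> lists {1..n}"
      by (simp_all add: B_word_append)
    then show ?thesis using True by simp
  next
    case False
    then have "u \<notin> lists {1..n} \<or> v \<notin> lists {1..n}" by auto
    then have "u' \<notin> lists {1..n} \<or> v' \<notin> lists {1..n}"
      using eq by (metis option.distinct(1))
    then have "u' @ v' \<notin> lists {1..n}" by auto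
    then show ?thesis using False by metis
  qed
  show "?F [s, s] = ?F [s]" if "s \<in> {1..n}" for s
    using that B_word_idem[of s ?Q] by simp
  show "?F [s, t] = ?F [t, s]" if "s \<in> {1..n}" "t \<in> {1..n}" "Suc s < t" for s t
  proof -
    \<comment> \<open>Distant vertices have no arrow in either direction, so both instances of the
      third relation hold and the braid relation joins them.\<close>
    have "?B [s, t] = ?B [t, s, t]"
      using that arrow[of t s] by (intro B_word_no_arrow[symmetric]) auto
    also have "\<dots> = ?B [s, t, s]"
      using that by (intro B_word_braid) auto
    also have "\<dots> = ?B [t, s]"
      using that arrow[of s t] by (intro B_word_no_arrow) auto
    finally show ?thesis using that by simp
  qed
  \<comment> \<open>The arrow joining these vertices runs from \<open>s\<close> to
    \<open>Suc s\<close>, so the third relation applies in this orientation; the braid relation then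
    gives the mirrored law.\<close>
  have left: "?B [Suc s, s, Suc s] = ?B [s, Suc s]" if "s \<in> {1..n}" "Suc s \<in> {1..n}" for s
    using that arrow[of "Suc s" s] by (intro B_word_no_arrow) auto
  then show "?F [Suc s, s, Suc s] = ?F [s, Suc s]" if "s \<in> {1..n}" "Suc s \<in> {1..n}" for s
    using that by simp
  have "?B [s, Suc s, s] = ?B [Suc s, s, Suc s]" if "s \<in> {1..n}" "Suc s \<in> {1..n}" for s
    using that by (intro B_word_braid) auto
  then show "?F [s, Suc s, s] = ?F [s, Suc s]" if "s \<in> {1..n}" "Suc s \<in> {1..n}" for s
    using that left[OF that] by simp
qed

lemma normal_words_mult_closed:
  assumes w: "w \<in> normal_words n" and t: "t \<in> {1..n}"
  shows "(B_word (linear_quiver n) w :: (nat list \<Rightarrow> 'k :: field) set)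
      \<otimes>\<^bsub>B_algebra (linear_quiver n)\<^esub> B_gen (linear_quiver n) t
    \<in> B_word (linear_quiver n) ` normal_words n"
proof -
  let ?Q = "linear_quiver n"
  let ?B = "B_word ?Q :: nat list \<Rightarrow> (nat list \<Rightarrow> 'k) set"
  let ?F = "\<lambda>w. if w \<in> lists {1..n} then Some (?B w) else None"
  obtain Js where Js: "interval_chain n Js" and w: "w = chain_word Js"
    using w by (auto simp: normal_words_eq)
  obtain Ks where Ks: "interval_chain n Ks" and eq: "?F (w @ [t]) = ?F (chain_word Ks)"
    using catalan_presentation.chain_word_append_letter[OF catalan_presentation_B_word Js t] w
    by blast
  have lists: "w \<in> lists {1..n}" "chain_word Ks \<in> lists {1..n}"
    using set_chain_word[OF Js] set_chain_word[OF Ks] by (auto simp: w)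
  have "?B w \<otimes>\<^bsub>B_algebra ?Q\<^esub> B_gen ?Q t = ?B (w @ [t])"
    using lists t by (simp add: B_word_append B_gen_eq_word)
  also have "\<dots> = ?B (chain_word Ks)"
    using eq lists t by simp
  finally show ?thesis
    using Ks by (auto simp: normal_words_eq)
qed

text \<open>Distinct chains have distinct maps, by injectivity with threshold 0, as right endpoints
  are positive. Points above \<open>n\<close> are fixed by every word over \<open>{1..n}\<close>, so
  the maps differ at an index of some \<open>M\<^sub>b\<close>.\<close>

lemma normal_words_separated:
  assumes "v \<in> normal_words n" "w \<in> normal_words n" "v \<noteq> w"
  obtains b where "b \<le> n" "foldr shift v b \<noteq> foldr shift w b"
proof -
  obtain Js Ks where Js: "interval_chain n Js" "v = chain_word Js"
    and Ks: "interval_chain n Ks" "w = chain_word Ks"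
    using assms(1,2) by (auto simp: normal_words_eq)
  have fixed: "foldr shift u x = x" if "n < x" "set u \<subseteq> {1..n}" for u x
    using that(2) by (induction u) (use that(1) in \<open>auto simp: shift_def\<close>)
  have "\<exists>x. foldr shift v x \<noteq> foldr shift w x"
  proof (rule ccontr)
    assume "\<nexists>x. foldr shift v x \<noteq> foldr shift w x"
    then have "Js = Ks"
      using Js Ks by (intro foldr_shift_chain_inj[of n Js Ks 0])
        (auto simp: interval_chain_def)
    then show False
      using assms(3) Js Ks by simp
  qed
  then obtain x where x: "foldr shift v x \<noteq> foldr shift w x" by blast
  moreover from x have "x \<le> n"
    using fixed[of x v] fixed[of x w] set_chain_word Js Ks by (metis not_le)
  ultimately show thesis by (rule that[rotated])
qed

theorem proposition3p7:
  fixes n :: nat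
  assumes "n \<ge> 1"
  shows "admissible_normal_form TYPE('k::field) (linear_quiver n) (normal_words n)"
  unfolding admissible_normal_form_def
proof (intro conjI ballI impI)
  let ?Q = "linear_quiver n"
  show "finite_acyclic_quiver ?Q" by (rule finite_acyclic_linear_quiver)
  show "normal_words n \<subseteq> lists (verts ?Q)"
    using set_chain_word by (fastforce simp: normal_words_eq)
  show "[] \<in> normal_words n"
    unfolding normal_words_eq by (rule image_eqI[of _ _ "[]"]) simp_all
  show "[t] \<in> normal_words n" if "t \<in> verts ?Q" for t
    unfolding normal_words_eq using that
    by (intro image_eqI[of _ _ "[(t, t)]"]) (simp_all add: interval_chain_Cons)
  show "x \<otimes>\<^bsub>B_algebra ?Q\<^esub> B_gen ?Q t \<in> B_word ?Q ` normal_words n"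
    if "x \<in> (B_word ?Q ` normal_words n :: (nat list \<Rightarrow> 'k) set set)" "t \<in> verts ?Q" for x t
    using that normal_words_mult_closed by auto
  show "\<exists>V :: (nat, nat, 'k, nat \<Rightarrow> 'k) rep.
      fin_dim_rep ?Q V \<and> \<not> rep_isomorphic ?Q (proj_word ?Q v V) (proj_word ?Q w V)"
    if v: "v \<in> normal_words n" and w: "w \<in> normal_words n" and vw: "v \<noteq> w" for v w
  proof -
    \<comment> \<open>The separating representation is \<open>M\<^sub>b\<close> at an index where
      the two maps differ: its projections are thin of different lengths.\<close>
    obtain b where b: "b \<le> n" and ne: "foldr shift v b \<noteq> foldr shift w b"
      using normal_words_separated[OF v w vw] .
    let ?V = "interval_rep b :: (nat, nat, 'k, nat \<Rightarrow> 'k) rep"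
    have V: "thin_rep n b ?V"
      using b by (rule thin_rep_interval_rep)
    have letters: "set u \<subseteq> {1..n}" if "u \<in> normal_words n" for u
      using that set_chain_word by (auto simp: normal_words_eq)
    have "thin_rep n (foldr shift v b) (proj_word ?Q v ?V)"
      "thin_rep n (foldr shift w b) (proj_word ?Q w ?V)"
      using thin_rep_proj_word[OF V] letters v w by blast+
    then have "\<not> rep_isomorphic ?Q (proj_word ?Q v ?V) (proj_word ?Q w ?V)"
      using ne thin_rep_isomorphic_imp_eq by blast
    then show ?thesis
      using fin_dim_rep_thin_rep[OF V] by blast
  qed
qed

end
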